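(* Let $X$ be a finite discrete space with at least two elements, $\Gamma$ a nonempty countable set, and $\varphi:\Gamma\to\Gamma$ a map. Let $\sigma_\varphi:X^\Gamma\to X^\Gamma$ be the generalized shift $\sigma_\varphi((x_\alpha)_{\alpha\in\Gamma})=(x_{\varphi(\alpha)})_{\alpha\in\Gamma}$. The following statements are equivalent: 1. the system $(X^\Gamma,\sigma_\varphi)$ is Li--Yorke chaotic; 2. the system $(X^\Gamma,\sigma_\varphi)$ is topologically chaotic; 3. the system $(X^\Gamma,\sigma_\varphi)$ is spatiotemporally chaotic; 4. the system $(X^\Gamma,\sigma_\varphi)$ is sensitive; 5. the system $(X^\Gamma,\sigma_\varphi)$ is Li--Yorke sensitive; 6. the system $(X^\Gamma,\sigma_\varphi)$ is strongly sensitive; 7. the system $(X^\Gamma,\sigma_\varphi)$ is asymptotic sensitive; 8. the system $(X^\Gamma,\sigma_\varphi)$ is syndetically sensitive; 9. the system $(X^\Gamma,\sigma_\varphi)$ is cofinitely sensitive; 10. the system $(X^\Gamma,\sigma_\varphi)$ is multi-sensitive; 11. the system $(X^\Gamma,\sigma_\varphi)$ is ergodically sensitive; 12. the map $\varphi:\Gamma\to\Gamma$ has at least one non-quasi-periodic point.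
   Context: $X^\Gamma$ carries the product topology. Write $\Gamma=\{\beta_1,\beta_2,\ldots\}$ for a fixed enumeration of $\Gamma$ (a finite list if $\Gamma$ is finite) and equip $X^\Gamma$ with the compatible metric $D((x_\alpha)_{\alpha\in\Gamma},(y_\alpha)_{\alpha\in\Gamma})=\sum_{n\ge1}\delta(x_{\beta_n},y_{\beta_n})/2^n$ (sum over the indices of the enumeration), where $\delta(a,b)=0$ if $a=b$ and $\delta(a,b)=1$ if $a\ne b$. A point $a\in\Gamma$ is a quasi-periodic point of $\varphi$ if there are $n>m\ge1$ with $\varphi^n(a)=\varphi^m(a)$; otherwise it is non-quasi-periodic. Let $f:Z\to Z$ be a continuous self-map of a compact metric space $(Z,d)$. Points $x,y\in Z$ are scrambled (and $(x,y)$ is a scrambled pair) if $\liminf_{n\to\infty}d(f^n(x),f^n(y))=0$ and $\limsup_{n\to\infty}d(f^n(x),f^n(y))>0$. $S(Z,f)$ is the set of scrambled pairs and, for $\varepsilon>0$, $S_\varepsilon(Z,f)=\{(x,y)\in S(Z,f):\limsup_{n\to\infty}d(f^n(x),f^n(y))>\varepsilon\}$. A scrambled set is a subset of $Z$ with at least two elements, every two distinct elements of which form a scrambled pair. "Opene" means nonempty and open. For $\varepsilon>0$ and open $V\subseteq Z$ let $N(V,\varepsilon)=\{n\ge0:\exists x,y\in V,\ d(f^n(x),f^n(y))>\varepsilon\}$. A set $A\subseteq\mathbb N\cup\{0\}$ is syndetic if there exists $N\ge1$ with $\{i,i+1,\ldots,i+N\}\cap A\ne\varnothing$ for all $i\ge1$;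 cofinite means having finite complement in $\mathbb N\cup\{0\}$, where $\mathbb N=\{1,2,\ldots\}$. The system $(Z,f)$ is: - Li--Yorke chaotic if $Z$ has an uncountable scrambled subset; - topologically chaotic if it has positive topological entropy; - spatiotemporally chaotic if for every $x\in Z$ and open neighbourhood $U$ of $x$ there exists $y\in U$ such that $x,y$ are scrambled; - sensitive if there exists $\varepsilon>0$ such that for all $x\in Z$ and every open neighbourhood $V$ of $x$ there exist $n\ge0$ and $y\in V$ with $d(f^n(x),f^n(y))>\varepsilon$; - Li--Yorke sensitive if there exists $\kappa>0$ such that for every $x\in Z$ and open neighbourhood $U$ of $x$ there exists $y\in U$ with $(x,y)\in S_\kappa(Z,f)$; - strongly sensitive if there exists $\varepsilon>0$ such that for all $x\in Z$ and every open neighbourhood $V$ of $x$ there exist $n_0\ge0$ and $y\in V$ with $d(f^n(x),f^n(y))>\varepsilon$ for all $n\ge n_0$; - asymptotic sensitive if there exists $\varepsilon>0$ such that for all $x\in Z$ and every open neighbourhood $V$ of $x$ there exists $y\in V$ with $\limsup_{n\to\infty}d(f^n(x),f^n(y))>\varepsilon$; - syndetically sensitive (resp. cofinitely sensitive) if there exists $\varepsilon>0$ such that for every opene $V\subseteq Z$, $N(V,\varepsilon)$ is syndetic (resp. cofinite); - multi-sensitive if there exists $\varepsilon>0$ such that for all $k\ge1$ and opene subsets $V_1,\ldots,V_k$ of $Z$, $\bigcap_{1\le n\le k}N(V_n,\varepsilon)\ne\varnothing$; - ergodically sensitive if there exists $\varepsilon>0$ such that for every opene $V\subseteq Z$, $\limsup_{n\to\infty}\frac{|N(V,\varepsilon)\cap\{0,\ldots,n\}|}{n+1}>0$.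 *)

theory Defs
  imports "HOL-Analysis.Analysis"
begin

section \<open>Scrambled pairs and chaos\<close>

text \<open>
  A system is given by a carrier \<open>Z\<close>, a metric \<open>d\<close> on \<open>Z\<close> and a map \<open>f\<close> from \<open>Z\<close> to \<open>Z\<close>; topological
  notions refer to the topology induced by \<open>d\<close>. The definitions are meaningful when
  \<open>Metric_space Z d\<close> holds, \<open>Z\<close> is compact and \<open>f\<close> is continuous; for the
  generalized shift this is proved at the end of this theory.
  The inferior and superior limits are taken in \<open>ereal\<close>, a complete lattice.
\<close>

definition scrambled_pairs :: "'a set \<Rightarrow> ('a \<Rightarrow> 'a \<Rightarrow> real) \<Rightarrow> ('a \<Rightarrow> 'a) \<Rightarrow> ('a \<times> 'a) set" where
  "scrambled_pairs Z d f = {(x, y). x \<in> Z \<and> y \<in> Z \<and>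
     liminf (\<lambda>n. ereal (d ((f ^^ n) x) ((f ^^ n) y))) = 0 \<and>
     limsup (\<lambda>n. ereal (d ((f ^^ n) x) ((f ^^ n) y))) > 0}"

definition scrambled_pairs_above ::
    "real \<Rightarrow> 'a set \<Rightarrow> ('a \<Rightarrow> 'a \<Rightarrow> real) \<Rightarrow> ('a \<Rightarrow> 'a) \<Rightarrow> ('a \<times> 'a) set" where
  "scrambled_pairs_above \<epsilon> Z d f = {(x, y) \<in> scrambled_pairs Z d f.
     limsup (\<lambda>n. ereal (d ((f ^^ n) x) ((f ^^ n) y))) > ereal \<epsilon>}"

definition scrambled_set :: "'a set \<Rightarrow> ('a \<Rightarrow> 'a \<Rightarrow> real) \<Rightarrow> ('a \<Rightarrow> 'a) \<Rightarrow> 'a set \<Rightarrow> bool" where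
  "scrambled_set Z d f A \<longleftrightarrow> A \<subseteq> Z \<and> (\<exists>x\<in>A. \<exists>y\<in>A. x \<noteq> y) \<and>
     (\<forall>x\<in>A. \<forall>y\<in>A. x \<noteq> y \<longrightarrow> (x, y) \<in> scrambled_pairs Z d f)"

definition Li_Yorke_chaotic :: "'a set \<Rightarrow> ('a \<Rightarrow> 'a \<Rightarrow> real) \<Rightarrow> ('a \<Rightarrow> 'a) \<Rightarrow> bool" where
  "Li_Yorke_chaotic Z d f \<longleftrightarrow> (\<exists>A. scrambled_set Z d f A \<and> uncountable A)"

definition open_nhd :: "'a set \<Rightarrow> ('a \<Rightarrow> 'a \<Rightarrow> real) \<Rightarrow> 'a \<Rightarrow> 'a set \<Rightarrow> bool" where
  "open_nhd Z d x U \<longleftrightarrow> openin (Metric_space.mtopology Z d) U \<and> x \<in> U"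

definition opene :: "'a set \<Rightarrow> ('a \<Rightarrow> 'a \<Rightarrow> real) \<Rightarrow> 'a set \<Rightarrow> bool" where
  "opene Z d U \<longleftrightarrow> openin (Metric_space.mtopology Z d) U \<and> U \<noteq> {}"

definition spatiotemporally_chaotic :: "'a set \<Rightarrow> ('a \<Rightarrow> 'a \<Rightarrow> real) \<Rightarrow> ('a \<Rightarrow> 'a) \<Rightarrow> bool" where
  "spatiotemporally_chaotic Z d f \<longleftrightarrow>
     (\<forall>x\<in>Z. \<forall>U. open_nhd Z d x U \<longrightarrow> (\<exists>y\<in>U. (x, y) \<in> scrambled_pairs Z d f))"


section \<open>Topological entropy\<close>

text \<open>The definition by open covers (Adler, Konheim and McAndrew).\<close>

definition open_covers :: "'a topology \<Rightarrow> 'a set set set" where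
  "open_covers T = {\<U>. (\<forall>U\<in>\<U>. openin T U) \<and> \<Union>\<U> = topspace T}"

text \<open>The common refinement of \<open>\<U>\<close> and its preimages under \<open>f\<close>, \<dots>, \<open>f ^^ (n - 1)\<close>.\<close>

definition iterated_join :: "'a topology \<Rightarrow> ('a \<Rightarrow> 'a) \<Rightarrow> 'a set set \<Rightarrow> nat \<Rightarrow> 'a set set" where
  "iterated_join T f \<U> n =
     {{z \<in> topspace T. \<forall>i<n. (f ^^ i) z \<in> V i} | V. \<forall>i<n. V i \<in> \<U>}"

definition min_subcover_card :: "'a topology \<Rightarrow> 'a set set \<Rightarrow> nat" where
  "min_subcover_card T \<W> = (LEAST k. \<exists>\<F>\<subseteq>\<W>. finite \<F> \<and> card \<F> = k \<and> \<Union>\<F> = topspace T)"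

text \<open>
  For compact \<open>T\<close> and continuous \<open>f\<close> the limit exists, by subadditivity of
  \<open>\<lambda>n. ln (min_subcover_card T (iterated_join T f \<U> n))\<close>.
\<close>

definition cover_entropy :: "'a topology \<Rightarrow> ('a \<Rightarrow> 'a) \<Rightarrow> 'a set set \<Rightarrow> real" where
  "cover_entropy T f \<U> =
     lim (\<lambda>n. ln (real (min_subcover_card T (iterated_join T f \<U> n))) / real n)"

definition topological_entropy :: "'a topology \<Rightarrow> ('a \<Rightarrow> 'a) \<Rightarrow> ereal" where
  "topological_entropy T f = (SUP \<U>\<in>open_covers T. ereal (cover_entropy T f \<U>))"

definition topologically_chaotic :: "'a set \<Rightarrow> ('a \<Rightarrow> 'a \<Rightarrow> real) \<Rightarrow> ('a \<Rightarrow> 'a) \<Rightarrow> bool" where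
  "topologically_chaotic Z d f \<longleftrightarrow> topological_entropy (Metric_space.mtopology Z d) f > 0"


section \<open>Notions of sensitivity\<close>

definition sensitive :: "'a set \<Rightarrow> ('a \<Rightarrow> 'a \<Rightarrow> real) \<Rightarrow> ('a \<Rightarrow> 'a) \<Rightarrow> bool" where
  "sensitive Z d f \<longleftrightarrow> (\<exists>\<epsilon>>0. \<forall>x\<in>Z. \<forall>V. open_nhd Z d x V \<longrightarrow>
     (\<exists>n. \<exists>y\<in>V. d ((f ^^ n) x) ((f ^^ n) y) > \<epsilon>))"

definition Li_Yorke_sensitive :: "'a set \<Rightarrow> ('a \<Rightarrow> 'a \<Rightarrow> real) \<Rightarrow> ('a \<Rightarrow> 'a) \<Rightarrow> bool" where
  "Li_Yorke_sensitive Z d f \<longleftrightarrow> (\<exists>\<kappa>>0. \<forall>x\<in>Z. \<forall>U. open_nhd Z d x U \<longrightarrow>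
     (\<exists>y\<in>U. (x, y) \<in> scrambled_pairs_above \<kappa> Z d f))"

definition strongly_sensitive :: "'a set \<Rightarrow> ('a \<Rightarrow> 'a \<Rightarrow> real) \<Rightarrow> ('a \<Rightarrow> 'a) \<Rightarrow> bool" where
  "strongly_sensitive Z d f \<longleftrightarrow> (\<exists>\<epsilon>>0. \<forall>x\<in>Z. \<forall>V. open_nhd Z d x V \<longrightarrow>
     (\<exists>n\<^sub>0. \<exists>y\<in>V. \<forall>n\<ge>n\<^sub>0. d ((f ^^ n) x) ((f ^^ n) y) > \<epsilon>))"

definition asymptotic_sensitive :: "'a set \<Rightarrow> ('a \<Rightarrow> 'a \<Rightarrow> real) \<Rightarrow> ('a \<Rightarrow> 'a) \<Rightarrow> bool" where
  "asymptotic_sensitive Z d f \<longleftrightarrow> (\<exists>\<epsilon>>0. \<forall>x\<in>Z. \<forall>V. open_nhd Z d x V \<longrightarrow>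
     (\<exists>y\<in>V. limsup (\<lambda>n. ereal (d ((f ^^ n) x) ((f ^^ n) y))) > ereal \<epsilon>))"

definition separation_times ::
    "('a \<Rightarrow> 'a \<Rightarrow> real) \<Rightarrow> ('a \<Rightarrow> 'a) \<Rightarrow> 'a set \<Rightarrow> real \<Rightarrow> nat set" where
  "separation_times d f V \<epsilon> = {n. \<exists>x\<in>V. \<exists>y\<in>V. d ((f ^^ n) x) ((f ^^ n) y) > \<epsilon>}"

definition syndetic :: "nat set \<Rightarrow> bool" where
  "syndetic A \<longleftrightarrow> (\<exists>N\<ge>1. \<forall>i\<ge>1. {i..i + N} \<inter> A \<noteq> {})"

definition syndetically_sensitive :: "'a set \<Rightarrow> ('a \<Rightarrow> 'a \<Rightarrow> real) \<Rightarrow> ('a \<Rightarrow> 'a) \<Rightarrow> bool" where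
  "syndetically_sensitive Z d f \<longleftrightarrow>
     (\<exists>\<epsilon>>0. \<forall>V. opene Z d V \<longrightarrow> syndetic (separation_times d f V \<epsilon>))"

definition cofinitely_sensitive :: "'a set \<Rightarrow> ('a \<Rightarrow> 'a \<Rightarrow> real) \<Rightarrow> ('a \<Rightarrow> 'a) \<Rightarrow> bool" where
  "cofinitely_sensitive Z d f \<longleftrightarrow>
     (\<exists>\<epsilon>>0. \<forall>V. opene Z d V \<longrightarrow> finite (- separation_times d f V \<epsilon>))"

definition multi_sensitive :: "'a set \<Rightarrow> ('a \<Rightarrow> 'a \<Rightarrow> real) \<Rightarrow> ('a \<Rightarrow> 'a) \<Rightarrow> bool" where
  "multi_sensitive Z d f \<longleftrightarrow> (\<exists>\<epsilon>>0. \<forall>k\<ge>1. \<forall>V :: nat \<Rightarrow> 'a set.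
     (\<forall>n\<in>{1..k}. opene Z d (V n)) \<longrightarrow> (\<Inter>n\<in>{1..k}. separation_times d f (V n) \<epsilon>) \<noteq> {})"

definition ergodically_sensitive :: "'a set \<Rightarrow> ('a \<Rightarrow> 'a \<Rightarrow> real) \<Rightarrow> ('a \<Rightarrow> 'a) \<Rightarrow> bool" where
  "ergodically_sensitive Z d f \<longleftrightarrow> (\<exists>\<epsilon>>0. \<forall>V. opene Z d V \<longrightarrow>
     limsup (\<lambda>n. ereal (real (card (separation_times d f V \<epsilon> \<inter> {0..n})) / real (n + 1))) > 0)"


section \<open>Generalized shifts\<close>

text \<open>
  The space of all families indexed by \<open>\<Gamma>\<close> with values in \<open>X\<close> is \<open>\<Gamma> \<rightarrow>\<^sub>E X\<close>, whose elements are
  \<open>undefined\<close> outside \<open>\<Gamma>\<close>; hence the restriction.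
\<close>

definition generalized_shift :: "'g set \<Rightarrow> ('g \<Rightarrow> 'g) \<Rightarrow> ('g \<Rightarrow> 'x) \<Rightarrow> ('g \<Rightarrow> 'x)" where
  "generalized_shift \<Gamma> \<phi> x = (\<lambda>\<alpha>\<in>\<Gamma>. x (\<phi> \<alpha>))"

definition enum_index :: "'g set \<Rightarrow> nat set" where
  "enum_index \<Gamma> = (if finite \<Gamma> then {1..card \<Gamma>} else {1..})"

definition is_enumeration :: "(nat \<Rightarrow> 'g) \<Rightarrow> 'g set \<Rightarrow> bool" where
  "is_enumeration \<beta> \<Gamma> \<longleftrightarrow> bij_betw \<beta> (enum_index \<Gamma>) \<Gamma>"

definition product_dist :: "'g set \<Rightarrow> (nat \<Rightarrow> 'g) \<Rightarrow> ('g \<Rightarrow> 'x) \<Rightarrow> ('g \<Rightarrow> 'x) \<Rightarrow> real" where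
  "product_dist \<Gamma> \<beta> x y =
     (\<Sum>\<^sub>\<infinity>n\<in>enum_index \<Gamma>. (if x (\<beta> n) = y (\<beta> n) then 0 else 1) / 2 ^ n)"

definition quasi_periodic :: "('g \<Rightarrow> 'g) \<Rightarrow> 'g \<Rightarrow> bool" where
  "quasi_periodic \<phi> a \<longleftrightarrow> (\<exists>n m. n > m \<and> m \<ge> 1 \<and> (\<phi> ^^ n) a = (\<phi> ^^ m) a)"


section \<open>The metric is compatible with the product topology\<close>

lemma sum_half_powers_less:
  assumes "finite F" "\<And>n. n \<in> F \<Longrightarrow> n > N"
  shows "(\<Sum>n\<in>F. 1 / 2 ^ n :: real) < 1 / 2 ^ N"
proof -
  obtain K where K: "F \<subseteq> {N<..N + K}"
  proof -
    obtain K where "\<forall>n\<in>F. n \<le> K" using assms(1) finite_nat_set_iff_bounded_le by auto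
    then have "F \<subseteq> {N<..N + K}" using assms(2) by (auto intro: trans_le_add2)
    then show thesis by (rule that)
  qed
  have "(\<Sum>n\<in>F. 1 / 2 ^ n :: real) \<le> (\<Sum>n\<in>{N<..N + K}. 1 / 2 ^ n)"
    by (rule sum_mono2) (use K in auto)
  also have "\<dots> = 1 / 2 ^ N - 1 / 2 ^ (N + K)"
  proof (induction K)
    case (Suc K)
    have "{N<..N + Suc K} = insert (N + Suc K) {N<..N + K}" by auto
    then show ?case using Suc by simp
  qed simp
  also have "\<dots> < 1 / 2 ^ N" by simp
  finally show ?thesis .
qed

lemma product_dist_summable:
  "(\<lambda>n. (if x (\<beta> n) = y (\<beta> n) then 0 else 1) / 2 ^ n :: real) summable_on enum_index \<Gamma>"
proof (rule nonneg_bdd_above_summable_on)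
  let ?f = "\<lambda>n. (if x (\<beta> n) = y (\<beta> n) then 0 else 1) / 2 ^ n :: real"
  show "bdd_above (sum ?f ` {F. F \<subseteq> enum_index \<Gamma> \<and> finite F})"
  proof (rule bdd_aboveI2)
    fix F assume F: "F \<in> {F. F \<subseteq> enum_index \<Gamma> \<and> finite F}"
    have "sum ?f F \<le> (\<Sum>n\<in>F. 1 / 2 ^ n)" by (rule sum_mono) auto
    also have "\<dots> < 1 / 2 ^ 0"
      by (rule sum_half_powers_less) (use F in \<open>auto simp: enum_index_def split: if_splits\<close>)
    finally show "sum ?f F \<le> 1" by simp
  qed
qed auto

lemma product_dist_small_imp_eq:
  assumes "product_dist \<Gamma> \<beta> x y < 1 / 2 ^ n" "n \<in> enum_index \<Gamma>"
  shows "x (\<beta> n) = y (\<beta> n)"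
proof (rule ccontr)
  assume neq: "x (\<beta> n) \<noteq> y (\<beta> n)"
  have "(\<Sum>n\<in>{n}. (if x (\<beta> n) = y (\<beta> n) then 0 else 1) / 2 ^ n :: real) \<le> product_dist \<Gamma> \<beta> x y"
    unfolding product_dist_def
    by (rule finite_sum_le_infsum[OF product_dist_summable]) (use assms in auto)
  with neq assms show False by simp
qed

lemma product_dist_le_if_eq:
  assumes "\<And>n. n \<in> enum_index \<Gamma> \<Longrightarrow> n \<le> N \<Longrightarrow> x (\<beta> n) = y (\<beta> n)"
  shows "product_dist \<Gamma> \<beta> x y \<le> 1 / 2 ^ N"
  unfolding product_dist_def
proof (rule infsum_le_finite_sums[OF product_dist_summable])
  fix F assume F: "finite F" "F \<subseteq> enum_index \<Gamma>"
  have "(\<Sum>n\<in>F. (if x (\<beta> n) = y (\<beta> n) then 0 else 1) / 2 ^ n :: real)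
      \<le> (\<Sum>n\<in>F. if n > N then 1 / 2 ^ n else 0)"
    by (rule sum_mono) (use F assms in \<open>auto simp: not_less\<close>)
  also have "\<dots> = (\<Sum>n\<in>{n \<in> F. n > N}. 1 / 2 ^ n)"
    using F by (simp add: sum.inter_filter)
  also have "\<dots> < 1 / 2 ^ N" by (rule sum_half_powers_less) (use F in auto)
  finally show "(\<Sum>n\<in>F. (if x (\<beta> n) = y (\<beta> n) then 0 else 1) / 2 ^ n :: real) \<le> 1 / 2 ^ N"
    by simp
qed

lemma Metric_space_product_dist:
  assumes "is_enumeration \<beta> \<Gamma>"
  shows "Metric_space (\<Gamma> \<rightarrow>\<^sub>E X) (product_dist \<Gamma> \<beta>)"
proof
  fix x y z :: "'a \<Rightarrow> 'b"
  show "0 \<le> product_dist \<Gamma> \<beta> x y"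
    unfolding product_dist_def by (rule infsum_nonneg) auto
  show "product_dist \<Gamma> \<beta> x y = product_dist \<Gamma> \<beta> y x"
    unfolding product_dist_def by (rule infsum_cong) auto
  show "product_dist \<Gamma> \<beta> x y = 0 \<longleftrightarrow> x = y" if "x \<in> \<Gamma> \<rightarrow>\<^sub>E X" "y \<in> \<Gamma> \<rightarrow>\<^sub>E X"
  proof
    assume "product_dist \<Gamma> \<beta> x y = 0"
    then have "x (\<beta> n) = y (\<beta> n)" if "n \<in> enum_index \<Gamma>" for n
      using product_dist_small_imp_eq[of \<Gamma> \<beta> x y n] that by simp
    then have "x \<alpha> = y \<alpha>" if "\<alpha> \<in> \<Gamma>" for \<alpha>
      using assms that unfolding is_enumeration_def bij_betw_def by (metis imageE)
    then show "x = y" using \<open>x \<in> \<Gamma> \<rightarrow>\<^sub>E X\<close> \<open>y \<in> \<Gamma> \<rightarrow>\<^sub>E X\<close> by (rule PiE_ext[rotated 2])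
  qed (simp add: product_dist_def)
  show "product_dist \<Gamma> \<beta> x z \<le> product_dist \<Gamma> \<beta> x y + product_dist \<Gamma> \<beta> y z"
    unfolding product_dist_def
    by (subst infsum_add[symmetric], rule product_dist_summable, rule product_dist_summable,
        rule infsum_mono, rule product_dist_summable,
        rule summable_on_add, rule product_dist_summable, rule product_dist_summable) auto
qed

lemma mtopology_product_dist:
  assumes \<beta>: "is_enumeration \<beta> \<Gamma>"
  shows "Metric_space.mtopology (\<Gamma> \<rightarrow>\<^sub>E X) (product_dist \<Gamma> \<beta>) =
         product_topology (\<lambda>_. discrete_topology X) \<Gamma>"
proof -
  let ?Z = "\<Gamma> \<rightarrow>\<^sub>E X" and ?d = "product_dist \<Gamma> \<beta>"
  let ?T = "product_topology (\<lambda>_. discrete_topology X) \<Gamma>"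
  interpret Metric_space ?Z ?d by (rule Metric_space_product_dist[OF \<beta>])
  have img: "\<beta> ` enum_index \<Gamma> = \<Gamma>" using \<beta> by (simp add: is_enumeration_def bij_betw_def)
  show ?thesis
    unfolding topology_eq
  proof (intro allI iffI)
    fix U assume U: "openin mtopology U"
    show "openin ?T U"
    proof (subst openin_subopen, intro ballI)
      fix x assume x: "x \<in> U"
      then obtain r where r: "r > 0" "mball x r \<subseteq> U" using U unfolding openin_mtopology by blast
      have xZ: "x \<in> ?Z" using x U unfolding openin_mtopology by blast
      obtain N where N: "1 / 2 ^ N < r"
        using real_arch_pow_inv[OF r(1), of "1/2"] by (auto simp: power_one_over)
      define S where "S \<alpha> = (if \<alpha> \<in> \<beta> ` {..N} then {x \<alpha>} else X)" for \<alpha>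
      have "openin ?T (Pi\<^sub>E \<Gamma> S)"
        unfolding openin_PiE_gen
      proof (intro disjI2 conjI ballI)
        show "finite {i \<in> \<Gamma>. S i \<noteq> topspace (discrete_topology X)}"
          by (rule finite_subset[of _ "\<beta> ` {..N}"]) (auto simp: S_def)
      qed (use xZ in \<open>auto simp: S_def\<close>)
      moreover have "x \<in> Pi\<^sub>E \<Gamma> S" using xZ by (auto simp: S_def)
      moreover have "Pi\<^sub>E \<Gamma> S \<subseteq> U"
      proof
        fix y assume y: "y \<in> Pi\<^sub>E \<Gamma> S"
        have "Pi\<^sub>E \<Gamma> S \<subseteq> ?Z" by (rule PiE_mono) (use xZ in \<open>auto simp: S_def\<close>)
        then have yZ: "y \<in> ?Z" using y by blast
        have "?d x y \<le> 1 / 2 ^ N"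
        proof (rule product_dist_le_if_eq)
          fix n assume n: "n \<in> enum_index \<Gamma>" "n \<le> N"
          then have "y (\<beta> n) \<in> S (\<beta> n)" using y img by (auto dest!: PiE_mem)
          then show "x (\<beta> n) = y (\<beta> n)" using n by (auto simp: S_def)
        qed
        then show "y \<in> U" using r N xZ yZ by (auto simp: subset_iff)
      qed
      ultimately show "\<exists>T. openin ?T T \<and> x \<in> T \<and> T \<subseteq> U" by blast
    qed
  next
    fix U assume U: "openin ?T U"
    show "openin mtopology U"
      unfolding openin_mtopology
    proof (intro conjI allI impI)
      show "U \<subseteq> ?Z" using openin_subset[OF U] by simp
      fix x assume x: "x \<in> U"
      obtain S where S: "finite {i \<in> \<Gamma>. S i \<noteq> X}" "x \<in> Pi\<^sub>E \<Gamma> S" "Pi\<^sub>E \<Gamma> S \<subseteq> U"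
        using U x unfolding openin_product_topology_alt by fastforce
      let ?J = "{i \<in> \<Gamma>. S i \<noteq> X}"
      have "?J \<subseteq> \<beta> ` enum_index \<Gamma>" using img by blast
      then obtain I where I: "finite I" "I \<subseteq> enum_index \<Gamma>" "?J = \<beta> ` I"
        using S(1) by (meson finite_subset_image)
      obtain N where N: "\<forall>n\<in>I. n \<le> N" using I(1) finite_nat_set_iff_bounded_le by auto
      have "mball x (1 / 2 ^ N) \<subseteq> Pi\<^sub>E \<Gamma> S"
      proof
        fix y assume "y \<in> mball x (1 / 2 ^ N)"
        then have y: "y \<in> ?Z" and d: "?d x y < 1 / 2 ^ N" by auto
        have "y i \<in> S i" if i: "i \<in> \<Gamma>" for i
        proof (cases "S i = X")
          case False
          then obtain n where n: "n \<in> I" "i = \<beta> n" using I(3) i by blast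
          have "?d x y < 1 / 2 ^ n"
          proof -
            have "(1::real) / 2 ^ N \<le> 1 / 2 ^ n"
              using N n(1) by (intro divide_left_mono power_increasing) auto
            then show ?thesis using d by simp
          qed
          then have "x i = y i" using product_dist_small_imp_eq n I(2) by blast
          then show ?thesis using S(2) i by (metis PiE_mem)
        qed (use y i in auto)
        then show "y \<in> Pi\<^sub>E \<Gamma> S" using y by auto
      qed
      then show "\<exists>r>0. mball x r \<subseteq> U" using S(3) by (intro exI[of _ "1 / 2 ^ N"]) auto
    qed
  qed
qed

lemma compact_space_product_dist:
  assumes "is_enumeration \<beta> \<Gamma>" "finite X"
  shows "compact_space (Metric_space.mtopology (\<Gamma> \<rightarrow>\<^sub>E X) (product_dist \<Gamma> \<beta>))"
  using assms by (simp add: mtopology_product_dist compact_space_product_topology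
      compact_space_discrete_topology)

lemma continuous_map_generalized_shift:
  assumes "is_enumeration \<beta> \<Gamma>" "\<phi> \<in> \<Gamma> \<rightarrow> \<Gamma>"
  shows "continuous_map (Metric_space.mtopology (\<Gamma> \<rightarrow>\<^sub>E X) (product_dist \<Gamma> \<beta>))
           (Metric_space.mtopology (\<Gamma> \<rightarrow>\<^sub>E X) (product_dist \<Gamma> \<beta>)) (generalized_shift \<Gamma> \<phi>)"
  unfolding mtopology_product_dist[OF assms(1)] continuous_map_componentwise
proof (intro conjI ballI)
  fix \<alpha> assume \<alpha>: "\<alpha> \<in> \<Gamma>"
  have "continuous_map (product_topology (\<lambda>_. discrete_topology X) \<Gamma>) (discrete_topology X)
          (\<lambda>x. x (\<phi> \<alpha>))"
    using continuous_map_product_projection[of "\<phi> \<alpha>" \<Gamma> "\<lambda>_. discrete_topology X"] \<alpha> assms(2)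
    by auto
  then show "continuous_map (product_topology (\<lambda>_. discrete_topology X) \<Gamma>) (discrete_topology X)
          (\<lambda>x. generalized_shift \<Gamma> \<phi> x \<alpha>)"
    using \<alpha> by (simp add: generalized_shift_def)
qed (auto simp: generalized_shift_def)

end

theory Submission
  imports Defs
begin

text \<open>
  Everything is decided by how a finite set of coordinates moves under \<open>\<phi>\<close>, since the \<open>n\<close>-th iterate
  of the shift reads at \<open>\<alpha>\<close> the coordinate \<open>(\<phi> ^^ n) \<alpha>\<close> of the original point.

  Suppose first that every point of \<open>\<Gamma>\<close> is quasi-periodic. Then every forward orbit is finite, so the
  finitely many coordinates that determine the distance up to \<open>\<epsilon>\<close> only ever read a fixed finite set
  of coordinates. Hence the iterates of the shift are equicontinuous
  (\<open>equicontinuous_generalized_shift\<close>). An equicontinuous system is not sensitive; it has no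
  scrambled pairs, because two orbits that come close once remain close; and by compactness its
  entropy is zero, because finitely many balls of a fixed radius follow every itinerary.
  All the other notions of sensitivity imply plain sensitivity.

  Suppose conversely that \<open>a\<close> is not quasi-periodic. Then the points \<open>(\<phi> ^^ n) a\<close> are pairwise distinct,
  so the successive symbols seen at \<open>a\<close> can be prescribed freely. Three choices are
  made. Changing a point at all late orbit points of \<open>a\<close> keeps it in a given neighbourhood and separates
  it for ever, which is strong sensitivity and yields all other notions of sensitivity except that of Li and
  Yorke. Changing it only at times
  \<open>i\<^sup>2\<close> separates it infinitely often, while the growing gaps between squares leave
  ever longer spells of agreement, so the pair is scrambled (\<open>scrambled_if_differ_on_square_times\<close>);
  the same lemma, applied to sequences coding subsets of \<open>nat\<close>, gives an uncountable scrambled set.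
  Finally the partition of the space by the symbol at \<open>a\<close> realises every word, so its entropy
  is \<open>ln (card X)\<close>.
\<close>

section \<open>Limits along real sequences\<close>

lemma limsup_ge_if_frequently_ge:
  fixes u :: "nat \<Rightarrow> real"
  assumes "\<exists>\<^sub>F n in sequentially. c \<le> u n"
  shows "ereal c \<le> limsup (\<lambda>n. ereal (u n))"
proof (rule ccontr)
  assume "\<not> ?thesis"
  then have "\<forall>\<^sub>F n in sequentially. ereal (u n) < ereal c"
    by (intro Limsup_lessD) simp
  then show False using assms by (simp add: frequently_def not_le)
qed

lemma liminf_eq_0_if_frequently_small:
  fixes u :: "nat \<Rightarrow> real"
  assumes "\<And>n. 0 \<le> u n" and "\<And>e. e > 0 \<Longrightarrow> \<exists>\<^sub>F n in sequentially. u n \<le> e"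
  shows "liminf (\<lambda>n. ereal (u n)) = 0"
proof (rule antisym)
  show "0 \<le> liminf (\<lambda>n. ereal (u n))"
    by (rule Liminf_bounded) (use assms(1) in auto)
  show "liminf (\<lambda>n. ereal (u n)) \<le> 0"
  proof (rule ccontr)
    assume "\<not> ?thesis"
    then obtain e where e: "0 < ereal e" "ereal e < liminf (\<lambda>n. ereal (u n))"
      using ereal_dense2 by (metis not_le)
    from less_LiminfD[OF e(2)] have "\<forall>\<^sub>F n in sequentially. e < u n" by simp
    then show False using assms(2)[of e] e(1) by (simp add: frequently_def not_le)
  qed
qed


section \<open>Relations between the notions of sensitivity\<close>

lemma funpow_in_carrier: "f \<in> A \<rightarrow> A \<Longrightarrow> x \<in> A \<Longrightarrow> (f ^^ n) x \<in> A"
  by (induction n) auto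

lemma strongly_sensitive_imp_asymptotic_sensitive:
  assumes "strongly_sensitive Z d f"
  shows "asymptotic_sensitive Z d f"
proof -
  obtain e where e: "e > 0" and *: "\<And>x V. x \<in> Z \<Longrightarrow> open_nhd Z d x V \<Longrightarrow>
      \<exists>n\<^sub>0. \<exists>y\<in>V. \<forall>n\<ge>n\<^sub>0. d ((f ^^ n) x) ((f ^^ n) y) > e"
    using assms unfolding strongly_sensitive_def by blast
  \<comment> \<open>A limit superior of terms above \<open>e\<close> may equal \<open>e\<close>, hence the smaller constant.\<close>
  have "\<exists>y\<in>V. limsup (\<lambda>n. ereal (d ((f ^^ n) x) ((f ^^ n) y))) > ereal (e / 2)"
    if V: "x \<in> Z" "open_nhd Z d x V" for x V
  proof -
    obtain n\<^sub>0 y where y: "y \<in> V" "\<forall>n\<ge>n\<^sub>0. d ((f ^^ n) x) ((f ^^ n) y) > e"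
      using *[OF V] by blast
    have "ereal (e / 2) < ereal e" using e by simp
    also have "\<dots> \<le> limsup (\<lambda>n. ereal (d ((f ^^ n) x) ((f ^^ n) y)))"
    proof (rule limsup_ge_if_frequently_ge, unfold frequently_sequentially, intro allI)
      fix N
      show "\<exists>n\<ge>N. e \<le> d ((f ^^ n) x) ((f ^^ n) y)"
        using y(2) by (intro exI[of _ "max N n\<^sub>0"]) (auto intro: less_imp_le)
    qed
    finally show ?thesis using y(1) by blast
  qed
  then show ?thesis using e unfolding asymptotic_sensitive_def
    by (intro exI[of _ "e / 2"]) auto
qed

lemma asymptotic_sensitive_imp_sensitive:
  assumes "asymptotic_sensitive Z d f"
  shows "sensitive Z d f"
proof -
  obtain e where e: "e > 0" and *: "\<And>x V. x \<in> Z \<Longrightarrow> open_nhd Z d x V \<Longrightarrow>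
      \<exists>y\<in>V. limsup (\<lambda>n. ereal (d ((f ^^ n) x) ((f ^^ n) y))) > ereal e"
    using assms unfolding asymptotic_sensitive_def by blast
  have "\<exists>n. \<exists>y\<in>V. d ((f ^^ n) x) ((f ^^ n) y) > e" if V: "x \<in> Z" "open_nhd Z d x V" for x V
    using *[OF V] Limsup_obtain by fastforce
  then show ?thesis using e unfolding sensitive_def by blast
qed

lemma Li_Yorke_sensitive_imp_asymptotic_sensitive:
  "Li_Yorke_sensitive Z d f \<Longrightarrow> asymptotic_sensitive Z d f"
  unfolding Li_Yorke_sensitive_def asymptotic_sensitive_def scrambled_pairs_above_def by fast

lemma Li_Yorke_sensitive_imp_spatiotemporally_chaotic:
  "Li_Yorke_sensitive Z d f \<Longrightarrow> spatiotemporally_chaotic Z d f"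
  unfolding Li_Yorke_sensitive_def spatiotemporally_chaotic_def scrambled_pairs_above_def by fast

lemma cofinitely_sensitive_imp_syndetically_sensitive:
  assumes "cofinitely_sensitive Z d f"
  shows "syndetically_sensitive Z d f"
proof -
  have "syndetic A" if A: "finite (- A)" for A :: "nat set"
  proof -
    obtain N where "- A \<subseteq> {..<N}" using finite_nat_bounded[OF A] by blast
    then have "i + Suc N \<in> {i..i + Suc N} \<inter> A" for i by force
    then show ?thesis unfolding syndetic_def by (intro exI[of _ "Suc N"] conjI allI impI) (simp, blast)
  qed
  then show ?thesis using assms
    unfolding cofinitely_sensitive_def syndetically_sensitive_def by blast
qed

lemma cofinitely_sensitive_imp_multi_sensitive:
  assumes "cofinitely_sensitive Z d f"
  shows "multi_sensitive Z d f"
proof -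
  obtain e where e: "e > 0"
    and cofin: "\<And>V. opene Z d V \<Longrightarrow> finite (- separation_times d f V e)"
    using assms unfolding cofinitely_sensitive_def by blast
  have "(\<Inter>n\<in>{1..k}. separation_times d f (V n) e) \<noteq> {}"
    if "\<forall>n\<in>{1..k}. opene Z d (V n)" for k :: nat and V
  proof
    assume "(\<Inter>n\<in>{1..k}. separation_times d f (V n) e) = {}"
    then have "(UNIV :: nat set) = (\<Union>n\<in>{1..k}. - separation_times d f (V n) e)" by blast
    moreover have "finite (\<Union>n\<in>{1..k}. - separation_times d f (V n) e)"
      using that cofin by blast
    ultimately show False using infinite_UNIV_nat by metis
  qed
  then show ?thesis using e unfolding multi_sensitive_def by blast
qed

lemma cofinitely_sensitive_imp_ergodically_sensitive:
  assumes "cofinitely_sensitive Z d f"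
  shows "ergodically_sensitive Z d f"
proof -
  \<comment> \<open>A set containing all numbers from \<open>N\<close> on already fills half of \<open>{0..n}\<close> once \<open>n \<ge> 2 * N\<close>.\<close>
  have "limsup (\<lambda>n. ereal (real (card (A \<inter> {0..n})) / real (n + 1))) > 0"
    if A: "finite (- A)" for A :: "nat set"
  proof -
    obtain N where N: "- A \<subseteq> {..<N}" using finite_nat_bounded[OF A] by blast
    have half: "1 / 2 \<le> real (card (A \<inter> {0..n})) / real (n + 1)" if n: "n \<ge> 2 * N" for n
    proof -
      have "{N..n} \<subseteq> A \<inter> {0..n}" using N by force
      then have "card {N..n} \<le> card (A \<inter> {0..n})" by (intro card_mono) auto
      then have "real (n + 1) \<le> 2 * real (card (A \<inter> {0..n}))" using n by simp
      then show ?thesis by (simp add: field_simps)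
    qed
    have "(0 :: ereal) < ereal (1 / 2)" by simp
    also have "\<dots> \<le> limsup (\<lambda>n. ereal (real (card (A \<inter> {0..n})) / real (n + 1)))"
    proof (rule limsup_ge_if_frequently_ge, unfold frequently_sequentially, intro allI)
      fix M
      show "\<exists>n\<ge>M. 1 / 2 \<le> real (card (A \<inter> {0..n})) / real (n + 1)"
        by (rule exI[of _ "max M (2 * N)"]) (intro conjI half, auto)
    qed
    finally show ?thesis .
  qed
  then show ?thesis using assms
    unfolding cofinitely_sensitive_def ergodically_sensitive_def by blast
qed

context Metric_space
begin

lemma strongly_sensitive_imp_cofinitely_sensitive:
  assumes "strongly_sensitive M d f"
  shows "cofinitely_sensitive M d f"
proof -
  obtain e where e: "e > 0" and *: "\<And>x V. x \<in> M \<Longrightarrow> open_nhd M d x V \<Longrightarrow>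
      \<exists>n\<^sub>0. \<exists>y\<in>V. \<forall>n\<ge>n\<^sub>0. d ((f ^^ n) x) ((f ^^ n) y) > e"
    using assms unfolding strongly_sensitive_def by blast
  have "finite (- separation_times d f V e)" if V: "opene M d V" for V
  proof -
    obtain x where x: "x \<in> V" using V by (auto simp: opene_def)
    have "x \<in> M" "open_nhd M d x V"
      using V x openin_subset[of mtopology V] by (auto simp: opene_def open_nhd_def)
    then obtain n\<^sub>0 y where y: "y \<in> V" "\<forall>n\<ge>n\<^sub>0. d ((f ^^ n) x) ((f ^^ n) y) > e"
      using * by blast
    have "- separation_times d f V e \<subseteq> {..<n\<^sub>0}"
      using x y unfolding separation_times_def by (auto simp: not_less[symmetric])
    then show ?thesis by (rule finite_subset) simp
  qed
  then show ?thesis using e unfolding cofinitely_sensitive_def by blast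
qed

text \<open>
  Two points of a neighbourhood of \<open>x\<close> that get more than \<open>\<epsilon>\<close> apart cannot both be within \<open>\<epsilon> / 2\<close> of the
  orbit of \<open>x\<close>; so nonempty sets of separation times already give sensitivity.
\<close>
lemma sensitive_if_separation_times_nonempty:
  assumes f: "f \<in> M \<rightarrow> M" and e: "e > 0"
    and sep: "\<And>V. opene M d V \<Longrightarrow> separation_times d f V e \<noteq> {}"
  shows "sensitive M d f"
proof -
  have "\<exists>n. \<exists>y\<in>V. d ((f ^^ n) x) ((f ^^ n) y) > e / 2"
    if x: "x \<in> M" and V: "open_nhd M d x V" for x V
  proof -
    have "opene M d V" using V by (auto simp: opene_def open_nhd_def)
    then obtain n u v where uv: "u \<in> V" "v \<in> V" "d ((f ^^ n) u) ((f ^^ n) v) > e"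
      using sep unfolding separation_times_def by blast
    have "V \<subseteq> M" using V openin_subset[of mtopology V] by (auto simp: open_nhd_def)
    then have "(f ^^ n) u \<in> M" "(f ^^ n) v \<in> M" "(f ^^ n) x \<in> M"
      using funpow_in_carrier[OF f] uv x by auto
    then have "d ((f ^^ n) u) ((f ^^ n) v)
        \<le> d ((f ^^ n) x) ((f ^^ n) u) + d ((f ^^ n) x) ((f ^^ n) v)"
      by (metis triangle commute)
    then show ?thesis using uv by (smt (verit) field_sum_of_halves)
  qed
  then show ?thesis using e unfolding sensitive_def by (intro exI[of _ "e / 2"]) auto
qed

lemma syndetically_sensitive_imp_sensitive:
  assumes "f \<in> M \<rightarrow> M" "syndetically_sensitive M d f"
  shows "sensitive M d f"
proof -
  have "A \<noteq> {}" if "syndetic A" for A using that unfolding syndetic_def by auto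
  then show ?thesis
    using assms sensitive_if_separation_times_nonempty
    unfolding syndetically_sensitive_def by metis
qed

lemma multi_sensitive_imp_sensitive:
  assumes f: "f \<in> M \<rightarrow> M" and multi: "multi_sensitive M d f"
  shows "sensitive M d f"
proof -
  obtain e where e: "e > 0" and *: "\<And>k V. k \<ge> 1 \<Longrightarrow> \<forall>n\<in>{1..k :: nat}. opene M d (V n) \<Longrightarrow>
      (\<Inter>n\<in>{1..k}. separation_times d f (V n) e) \<noteq> {}"
    using multi unfolding multi_sensitive_def by blast
  show ?thesis
    using f e by (rule sensitive_if_separation_times_nonempty) (use *[of 1 "\<lambda>_. _"] in auto)
qed

lemma ergodically_sensitive_imp_sensitive:
  assumes f: "f \<in> M \<rightarrow> M" and erg: "ergodically_sensitive M d f"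
  shows "sensitive M d f"
proof -
  obtain e where e: "e > 0" and *: "\<And>V. opene M d V \<Longrightarrow>
      limsup (\<lambda>n. ereal (real (card (separation_times d f V e \<inter> {0..n})) / real (n + 1))) > 0"
    using erg unfolding ergodically_sensitive_def by blast
  have "separation_times d f V e \<noteq> {}" if "opene M d V" for V
  proof
    assume "separation_times d f V e = {}"
    with *[OF that] have "limsup (\<lambda>n. 0 :: ereal) > 0" by (simp add: zero_ereal_def)
    then show False by (simp add: Limsup_const)
  qed
  with f e show ?thesis by (rule sensitive_if_separation_times_nonempty)
qed


section \<open>Equicontinuous systems\<close>

definition equicontinuous_iterates :: "('a \<Rightarrow> 'a) \<Rightarrow> bool" where
  "equicontinuous_iterates f \<longleftrightarrow> (\<forall>\<epsilon>>0. \<exists>\<delta>>0. \<forall>x\<in>M. \<forall>y\<in>M. d x y < \<delta> \<longrightarrow>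
     (\<forall>n. d ((f ^^ n) x) ((f ^^ n) y) \<le> \<epsilon>))"

lemma equicontinuous_iteratesE:
  assumes "equicontinuous_iterates f" "\<epsilon> > 0"
  obtains \<delta> where "\<delta> > 0"
    "\<And>x y n. x \<in> M \<Longrightarrow> y \<in> M \<Longrightarrow> d x y < \<delta> \<Longrightarrow> d ((f ^^ n) x) ((f ^^ n) y) \<le> \<epsilon>"
proof -
  obtain \<delta> where "\<delta> > 0" "\<forall>x\<in>M. \<forall>y\<in>M. d x y < \<delta> \<longrightarrow> (\<forall>n. d ((f ^^ n) x) ((f ^^ n) y) \<le> \<epsilon>)"
    using assms unfolding equicontinuous_iterates_def by blast
  then show thesis by (intro that[of \<delta>]) auto
qed

lemma equicontinuous_imp_not_sensitive:
  assumes "equicontinuous_iterates f" "M \<noteq> {}"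
  shows "\<not> sensitive M d f"
proof
  assume "sensitive M d f"
  then obtain e where e: "e > 0" and *: "\<And>x V. x \<in> M \<Longrightarrow> open_nhd M d x V \<Longrightarrow>
      \<exists>n. \<exists>y\<in>V. d ((f ^^ n) x) ((f ^^ n) y) > e"
    unfolding sensitive_def by blast
  obtain \<delta> where \<delta>: "\<delta> > 0"
    "\<And>x y n. x \<in> M \<Longrightarrow> y \<in> M \<Longrightarrow> d x y < \<delta> \<Longrightarrow> d ((f ^^ n) x) ((f ^^ n) y) \<le> e"
    using equicontinuous_iteratesE[OF assms(1) e] by blast
  obtain x where x: "x \<in> M" using assms(2) by blast
  then have "open_nhd M d x (mball x \<delta>)" using \<delta>(1) by (simp add: open_nhd_def)
  from *[OF x this] \<delta>(2)[OF x] show False by (auto simp: not_less[symmetric])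
qed

text \<open>
  A scrambled pair comes closer than every \<open>\<delta>\<close> at some time, and from then on equicontinuity keeps it
  closer than \<open>\<epsilon>\<close>; so it is asymptotic.
\<close>
lemma equicontinuous_imp_no_scrambled_pairs:
  assumes f: "f \<in> M \<rightarrow> M" and eq: "equicontinuous_iterates f"
  shows "scrambled_pairs M d f = {}"
proof (rule ccontr)
  assume "scrambled_pairs M d f \<noteq> {}"
  then obtain x y where xy: "x \<in> M" "y \<in> M"
    and inf0: "liminf (\<lambda>n. ereal (d ((f ^^ n) x) ((f ^^ n) y))) = 0"
    and sup: "limsup (\<lambda>n. ereal (d ((f ^^ n) x) ((f ^^ n) y))) > 0"
    unfolding scrambled_pairs_def by auto
  obtain e where e: "0 < ereal e" "ereal e < limsup (\<lambda>n. ereal (d ((f ^^ n) x) ((f ^^ n) y)))"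
    using sup ereal_dense2 by blast
  then have "e > 0" by simp
  then obtain \<delta> where \<delta>: "\<delta> > 0"
    "\<And>x y n. x \<in> M \<Longrightarrow> y \<in> M \<Longrightarrow> d x y < \<delta> \<Longrightarrow> d ((f ^^ n) x) ((f ^^ n) y) \<le> e"
    using equicontinuous_iteratesE[OF eq] by blast
  have "\<exists>N. d ((f ^^ N) x) ((f ^^ N) y) < \<delta>"
  proof (rule ccontr)
    assume "\<nexists>N. d ((f ^^ N) x) ((f ^^ N) y) < \<delta>"
    then have "ereal \<delta> \<le> liminf (\<lambda>n. ereal (d ((f ^^ n) x) ((f ^^ n) y)))"
      by (intro Liminf_bounded) (auto simp: not_less)
    then show False using inf0 \<delta>(1) by simp
  qed
  then obtain N where N: "d ((f ^^ N) x) ((f ^^ N) y) < \<delta>" by blast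
  have "d ((f ^^ n) x) ((f ^^ n) y) \<le> e" if "n \<ge> N" for n
  proof -
    have "(f ^^ n) z = (f ^^ (n - N)) ((f ^^ N) z)" for z
      using that by (metis funpow_add comp_apply le_add_diff_inverse2)
    moreover have "(f ^^ N) x \<in> M" "(f ^^ N) y \<in> M"
      using funpow_in_carrier[OF f] xy by auto
    ultimately show ?thesis using \<delta>(2) N by simp
  qed
  then have "limsup (\<lambda>n. ereal (d ((f ^^ n) x) ((f ^^ n) y))) \<le> ereal e"
    by (intro Limsup_bounded) (auto simp: eventually_sequentially)
  then show False using e(2) by simp
qed

text \<open>
  Take a Lebesgue number \<open>\<epsilon>\<close> of the cover and a \<open>\<delta>\<close> belonging to \<open>\<epsilon> / 2\<close>. The whole \<open>\<delta>\<close>-ball around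
  \<open>x\<close> follows the itinerary of \<open>x\<close>, so a finite \<open>\<delta>\<close>-net bounds the size of a subcover for all \<open>n\<close> at once.
\<close>
lemma equicontinuous_imp_min_subcover_card_bounded:
  assumes f: "f \<in> M \<rightarrow> M" and eq: "equicontinuous_iterates f"
    and cpt: "compact_space mtopology" and \<U>: "\<U> \<in> open_covers mtopology"
  shows "\<exists>K. \<forall>n. min_subcover_card mtopology (iterated_join mtopology f \<U> n) \<le> K"
proof -
  have cpt': "compactin mtopology M" using cpt by (simp add: compact_space_def)
  obtain \<epsilon> where \<epsilon>: "\<epsilon> > 0" "\<forall>x\<in>M. \<exists>U\<in>\<U>. mball x \<epsilon> \<subseteq> U"
    using lebesgue_number[OF cpt', of \<U>] \<U> by (auto simp: open_covers_def)
  then obtain h where h: "\<And>x. x \<in> M \<Longrightarrow> h x \<in> \<U> \<and> mball x \<epsilon> \<subseteq> h x" by metis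
  obtain \<delta> where \<delta>: "\<delta> > 0"
    "\<And>x y n. x \<in> M \<Longrightarrow> y \<in> M \<Longrightarrow> d x y < \<delta> \<Longrightarrow> d ((f ^^ n) x) ((f ^^ n) y) \<le> \<epsilon> / 2"
    using equicontinuous_iteratesE[OF eq, of "\<epsilon> / 2"] \<epsilon>(1) by (metis half_gt_zero)
  obtain K where K: "finite K" "K \<subseteq> M" "M \<subseteq> (\<Union>x\<in>K. mball x \<delta>)"
    using compactin_imp_mtotally_bounded[OF cpt', unfolded mtotally_bounded_def, rule_format, OF \<delta>(1)]
    by (elim exE conjE)
  have "min_subcover_card mtopology (iterated_join mtopology f \<U> n) \<le> card K" for n
  proof -
    define W where "W x = {z \<in> M. \<forall>i<n. (f ^^ i) z \<in> h ((f ^^ i) x)}" for x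
    note orbit = funpow_in_carrier[OF f]
    have sub: "W ` K \<subseteq> iterated_join mtopology f \<U> n"
    proof
      fix S assume "S \<in> W ` K"
      then obtain x where x: "x \<in> K" "S = W x" by blast
      have "x \<in> M" using x(1) K(2) by blast
      then have "h ((f ^^ i) x) \<in> \<U>" for i using h[OF orbit] by blast
      then show "S \<in> iterated_join mtopology f \<U> n"
        unfolding iterated_join_def x(2) W_def
        by (intro CollectI exI[of _ "\<lambda>i. h ((f ^^ i) x)"]) simp
    qed
    have cover: "\<Union>(W ` K) = M"
    proof
      show "M \<subseteq> \<Union>(W ` K)"
      proof
        fix z assume z: "z \<in> M"
        then obtain x where x: "x \<in> K" "d x z < \<delta>" using K(3) by auto
        have xM: "x \<in> M" using x(1) K(2) by blast
        have "(f ^^ i) z \<in> h ((f ^^ i) x)" for i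
        proof -
          have "d ((f ^^ i) x) ((f ^^ i) z) \<le> \<epsilon> / 2" using \<delta>(2)[OF xM z x(2)] .
          then have "(f ^^ i) z \<in> mball ((f ^^ i) x) \<epsilon>"
            using orbit[OF xM] orbit[OF z] \<epsilon>(1) by simp
          then show ?thesis using h[OF orbit[OF xM, of i]] by blast
        qed
        then show "z \<in> \<Union>(W ` K)" using x(1) z by (auto simp: W_def)
      qed
    qed (auto simp: W_def)
    have "min_subcover_card mtopology (iterated_join mtopology f \<U> n) \<le> card (W ` K)"
      unfolding min_subcover_card_def
      by (rule Least_le) (use sub cover K(1) in \<open>auto intro!: exI[of _ "W ` K"]\<close>)
    also have "\<dots> \<le> card K" by (rule card_image_le[OF K(1)])
    finally show ?thesis .
  qed
  then show ?thesis by blast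
qed

lemma equicontinuous_imp_not_topologically_chaotic:
  assumes f: "f \<in> M \<rightarrow> M" and eq: "equicontinuous_iterates f" and cpt: "compact_space mtopology"
  shows "\<not> topologically_chaotic M d f"
proof -
  have "cover_entropy mtopology f \<U> = 0" if \<U>: "\<U> \<in> open_covers mtopology" for \<U>
  proof -
    let ?k = "\<lambda>n. min_subcover_card mtopology (iterated_join mtopology f \<U> n)"
    obtain K where K: "\<And>n. ?k n \<le> K"
      using equicontinuous_imp_min_subcover_card_bounded[OF f eq cpt \<U>] by blast
    \<comment> \<open>\<open>Suc K\<close> rather than \<open>K\<close> keeps the argument of the logarithm positive when \<open>K = 0\<close>.\<close>
    have lnle: "\<bar>ln (real (?k n))\<bar> \<le> ln (real (Suc K))" for n
    proof (cases "?k n = 0")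
      case False
      then have "0 \<le> ln (real (?k n))" by simp
      moreover have "ln (real (?k n)) \<le> ln (real (Suc K))"
        using False K[of n] by (subst ln_le_cancel_iff) auto
      ultimately show ?thesis by simp
    qed simp
    have "(\<lambda>n. ln (real (?k n)) / real n) \<longlonglongrightarrow> 0"
    proof (rule Lim_null_comparison)
      show "\<forall>\<^sub>F n in sequentially. norm (ln (real (?k n)) / real n) \<le> ln (real (Suc K)) / real n"
        using lnle by (intro always_eventually allI) (auto simp: abs_divide intro!: divide_right_mono)
      show "(\<lambda>n. ln (real (Suc K)) / real n) \<longlonglongrightarrow> 0" by (rule lim_const_over_n)
    qed
    then show ?thesis unfolding cover_entropy_def by (rule limI)
  qed
  then have "topological_entropy mtopology f \<le> 0"
    unfolding topological_entropy_def by (auto intro!: SUP_least)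
  then show ?thesis unfolding topologically_chaotic_def by simp
qed

end


section \<open>Entropy of a partition that realises every word\<close>

text \<open>
  The cells of the \<open>n\<close>-th join of a partition are pairwise disjoint, so a subcover cannot omit a nonempty
  one; if all words are realised there are exactly \<open>card \<P> ^ n\<close> of them.
\<close>
lemma min_subcover_card_iterated_join_partition:
  assumes f: "f \<in> topspace T \<rightarrow> topspace T"
    and fin: "finite \<P>" and cover: "\<Union>\<P> = topspace T"
    and disj: "\<And>P Q. P \<in> \<P> \<Longrightarrow> Q \<in> \<P> \<Longrightarrow> P \<inter> Q \<noteq> {} \<Longrightarrow> P = Q"
    and words: "\<And>V. \<forall>i<n. V i \<in> \<P> \<Longrightarrow> \<exists>z\<in>topspace T. \<forall>i<n. (f ^^ i) z \<in> V i"
  shows "min_subcover_card T (iterated_join T f \<P> n) = card \<P> ^ n"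
proof -
  define cell where "cell V = {z \<in> topspace T. \<forall>i<n. (f ^^ i) z \<in> V i}" for V
  let ?W = "{..<n} \<rightarrow>\<^sub>E \<P>"
  have join: "iterated_join T f \<P> n = cell ` ?W"
  proof
    show "iterated_join T f \<P> n \<subseteq> cell ` ?W"
    proof
      fix S assume "S \<in> iterated_join T f \<P> n"
      then obtain V where V: "S = cell V" "\<forall>i<n. V i \<in> \<P>"
        unfolding iterated_join_def cell_def mem_Collect_eq by (elim exE conjE)
      have "S = cell (restrict V {..<n})" using V(1) by (simp add: cell_def cong: conj_cong)
      moreover have "restrict V {..<n} \<in> ?W" using V(2) by simp
      ultimately show "S \<in> cell ` ?W" by (rule image_eqI)
    qed
    show "cell ` ?W \<subseteq> iterated_join T f \<P> n"
      unfolding iterated_join_def cell_def by (rule image_subsetI) (intro CollectI exI conjI, auto)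
  qed
  have same: "V = V'" if "V \<in> ?W" "V' \<in> ?W" "z \<in> cell V" "z \<in> cell V'" for V V' z
    using that(1,2)
  proof (rule PiE_ext)
    fix i assume "i \<in> {..<n}"
    then have "(f ^^ i) z \<in> V i \<inter> V' i" "V i \<in> \<P>" "V' i \<in> \<P>"
      using that by (auto simp: cell_def)
    then show "V i = V' i" using disj by blast
  qed
  have nonempty: "\<exists>z. z \<in> cell V" if "V \<in> ?W" for V
    using words[of V] that by (auto simp: cell_def)
  have "inj_on cell ?W"
  proof (rule inj_onI)
    fix V V' assume V: "V \<in> ?W" "V' \<in> ?W" "cell V = cell V'"
    obtain z where "z \<in> cell V" using nonempty[OF V(1)] by blast
    with V show "V = V'" by (intro same) auto
  qed
  then have card: "card (iterated_join T f \<P> n) = card \<P> ^ n"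
    by (simp add: join card_image card_funcsetE)
  have finj: "finite (iterated_join T f \<P> n)"
    unfolding join using fin by (intro finite_imageI finite_PiE) auto
  have full: "\<Union>(iterated_join T f \<P> n) = topspace T"
  proof
    show "topspace T \<subseteq> \<Union>(iterated_join T f \<P> n)"
    proof
      fix z assume z: "z \<in> topspace T"
      have "\<exists>P\<in>\<P>. (f ^^ i) z \<in> P" for i
        using funpow_in_carrier[OF f z, of i] cover by blast
      then obtain V where "\<And>i. V i \<in> \<P> \<and> (f ^^ i) z \<in> V i" by metis
      then show "z \<in> \<Union>(iterated_join T f \<P> n)"
        unfolding iterated_join_def using z by blast
    qed
  qed (auto simp: iterated_join_def)
  have rigid: "\<F> = iterated_join T f \<P> n"
    if \<F>: "\<F> \<subseteq> iterated_join T f \<P> n" "\<Union>\<F> = topspace T" for \<F>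
  proof
    show "iterated_join T f \<P> n \<subseteq> \<F>"
    proof
      fix S assume "S \<in> iterated_join T f \<P> n"
      then obtain V where V: "V \<in> ?W" "S = cell V" unfolding join by blast
      then obtain z where z: "z \<in> cell V" using nonempty by blast
      then have "z \<in> topspace T" by (simp add: cell_def)
      then obtain S' where S': "S' \<in> \<F>" "z \<in> S'" using \<F>(2) by blast
      have "S' \<in> cell ` ?W" using S'(1) \<F>(1) unfolding join by (rule rev_subsetD)
      then obtain V' where V': "V' \<in> ?W" "S' = cell V'" by blast
      then show "S \<in> \<F>" using same[OF V(1) V'(1) z] S' V(2) by simp
    qed
  qed (rule \<F>(1))
  have "(\<exists>\<F>\<subseteq>iterated_join T f \<P> n. finite \<F> \<and> card \<F> = k \<and> \<Union>\<F> = topspace T)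
      \<longleftrightarrow> k = card \<P> ^ n" for k
  proof
    assume "\<exists>\<F>\<subseteq>iterated_join T f \<P> n. finite \<F> \<and> card \<F> = k \<and> \<Union>\<F> = topspace T"
    then obtain \<F> where \<F>: "\<F> \<subseteq> iterated_join T f \<P> n" "card \<F> = k" "\<Union>\<F> = topspace T" by blast
    then show "k = card \<P> ^ n" using rigid[OF \<F>(1,3)] card by simp
  next
    assume "k = card \<P> ^ n"
    then show "\<exists>\<F>\<subseteq>iterated_join T f \<P> n. finite \<F> \<and> card \<F> = k \<and> \<Union>\<F> = topspace T"
      by (intro exI[of _ "iterated_join T f \<P> n"] conjI order_refl finj full) (simp add: card)
  qed
  then show ?thesis unfolding min_subcover_card_def by (simp add: Least_equality)
qed

lemma cover_entropy_partition:
  assumes "f \<in> topspace T \<rightarrow> topspace T" "finite \<P>" "\<Union>\<P> = topspace T"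
    and "\<And>P Q. P \<in> \<P> \<Longrightarrow> Q \<in> \<P> \<Longrightarrow> P \<inter> Q \<noteq> {} \<Longrightarrow> P = Q"
    and "\<And>n V. \<forall>i<n. V i \<in> \<P> \<Longrightarrow> \<exists>z\<in>topspace T. \<forall>i<n. (f ^^ i) z \<in> V i"
  shows "cover_entropy T f \<P> = ln (real (card \<P>))"
proof -
  have "min_subcover_card T (iterated_join T f \<P> n) = card \<P> ^ n" for n
    by (rule min_subcover_card_iterated_join_partition) (use assms in auto)
  moreover have "ln (real (card \<P> ^ n)) / real n = ln (real (card \<P>))" if "n \<ge> 1" for n
    using that by (cases "card \<P> = 0") (auto simp: ln_realpow power_0_left)
  ultimately have "\<forall>\<^sub>F n in sequentially.
      ln (real (min_subcover_card T (iterated_join T f \<P> n))) / real n = ln (real (card \<P>))"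
    by (auto simp: eventually_sequentially)
  then show ?thesis unfolding cover_entropy_def by (intro limI tendsto_eventually)
qed


section \<open>Orbits of quasi-periodic and non-quasi-periodic points\<close>

lemma finite_orbit_if_quasi_periodic:
  assumes "quasi_periodic \<phi> a"
  shows "finite (range (\<lambda>n. (\<phi> ^^ n) a))"
proof -
  obtain n m where nm: "n > m" "(\<phi> ^^ n) a = (\<phi> ^^ m) a"
    using assms unfolding quasi_periodic_def by blast
  have "(\<phi> ^^ i) a \<in> (\<lambda>j. (\<phi> ^^ j) a) ` {..<n}" for i
  proof (induction i rule: less_induct)
    case (less i)
    show ?case
    proof (cases "i < n")
      case False
      have "(\<phi> ^^ i) a = (\<phi> ^^ (i - n)) ((\<phi> ^^ n) a)"
        using False by (metis funpow_add comp_apply le_add_diff_inverse2 not_less)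
      also have "\<dots> = (\<phi> ^^ (i - n + m)) a" by (simp add: nm(2) funpow_add)
      finally show ?thesis using less[of "i - n + m"] False nm(1) by simp
    qed auto
  qed
  then have "range (\<lambda>n. (\<phi> ^^ n) a) \<subseteq> (\<lambda>j. (\<phi> ^^ j) a) ` {..<n}" by blast
  then show ?thesis by (rule finite_subset) simp
qed

lemma inj_orbit_if_not_quasi_periodic:
  assumes "\<not> quasi_periodic \<phi> a"
  shows "inj (\<lambda>n. (\<phi> ^^ n) a)"
proof (rule linorder_inj_onI')
  fix i j :: nat assume "i < j"
  \<comment> \<open>Quasi-periodicity compares positive times only, so an equality at times \<open>i < j\<close> is shifted by one.\<close>
  then show "(\<phi> ^^ i) a \<noteq> (\<phi> ^^ j) a"
    using assms unfolding quasi_periodic_def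
    by (metis Suc_less_eq One_nat_def Suc_le_mono funpow.simps(2) comp_apply le0)
qed


section \<open>The generalized shift\<close>

lemma product_dist_ge_if_differ:
  assumes "k \<in> enum_index \<Gamma>" "x (\<beta> k) \<noteq> y (\<beta> k)"
  shows "1 / 2 ^ k \<le> product_dist \<Gamma> \<beta> x y"
  using assms product_dist_small_imp_eq by (metis not_le)

lemma half_power_less:
  assumes "(\<epsilon> :: real) > 0"
  obtains N :: nat where "1 / 2 ^ N < \<epsilon>"
  using real_arch_pow_inv[OF assms, of "1/2"] by (auto simp: power_one_over)

lemma half_power_Suc_less: "(1 / 2 ^ Suc n :: real) < 1 / 2 ^ n"
  by (intro divide_strict_left_mono) auto

locale shift_system =
  fixes X :: "'x set" and \<Gamma> :: "'g set" and \<phi> :: "'g \<Rightarrow> 'g" and \<beta> :: "nat \<Rightarrow> 'g"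
  assumes phi: "\<phi> \<in> \<Gamma> \<rightarrow> \<Gamma>" and enum: "is_enumeration \<beta> \<Gamma>"
begin

abbreviation "Z \<equiv> \<Gamma> \<rightarrow>\<^sub>E X"
abbreviation "D \<equiv> product_dist \<Gamma> \<beta>"
abbreviation "\<sigma> \<equiv> generalized_shift \<Gamma> \<phi>"

sublocale Metric_space Z D by (rule Metric_space_product_dist[OF enum])

lemma orbit_in: "\<alpha> \<in> \<Gamma> \<Longrightarrow> (\<phi> ^^ n) \<alpha> \<in> \<Gamma>"
  using phi by (rule funpow_in_carrier)

lemma shift_funcset: "\<sigma> \<in> Z \<rightarrow> Z"
  using phi by (auto simp: generalized_shift_def PiE_def Pi_def extensional_def)

lemma funpow_shift: "\<alpha> \<in> \<Gamma> \<Longrightarrow> (\<sigma> ^^ n) x \<alpha> = x ((\<phi> ^^ n) \<alpha>)"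
proof (induction n arbitrary: \<alpha>)
  case (Suc n)
  then have "\<phi> \<alpha> \<in> \<Gamma>" using phi by auto
  then show ?case using Suc by (simp add: generalized_shift_def funpow_swap1)
qed simp

definition initial_coords :: "nat \<Rightarrow> 'g set" where
  "initial_coords N = \<beta> ` {n \<in> enum_index \<Gamma>. n \<le> N}"

lemma finite_initial_coords: "finite (initial_coords N)"
  unfolding initial_coords_def by (rule finite_imageI, rule finite_subset[of _ "{..N}"]) auto

lemma initial_coords_subset: "initial_coords N \<subseteq> \<Gamma>"
  using enum by (auto simp: initial_coords_def is_enumeration_def bij_betw_def)

lemma dist_le_if_eq_on_initial_coords:
  assumes "\<And>\<alpha>. \<alpha> \<in> initial_coords N \<Longrightarrow> x \<alpha> = y \<alpha>"
  shows "D x y \<le> 1 / 2 ^ N"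
  by (rule product_dist_le_if_eq) (use assms in \<open>auto simp: initial_coords_def\<close>)

text \<open>
  If \<open>N\<close> bounds the indices of the finitely many coordinates, a difference at any one of them costs a
  distance of at least \<open>1 / 2 ^ N\<close>.
\<close>
lemma eq_on_finite_if_close:
  assumes J: "finite J" "J \<subseteq> \<Gamma>"
  obtains \<delta> where "\<delta> > 0" "\<And>x y \<alpha>. D x y < \<delta> \<Longrightarrow> \<alpha> \<in> J \<Longrightarrow> x \<alpha> = y \<alpha>"
proof -
  have "J \<subseteq> \<beta> ` enum_index \<Gamma>" using J enum by (auto simp: is_enumeration_def bij_betw_def)
  then obtain I where I: "finite I" "I \<subseteq> enum_index \<Gamma>" "J = \<beta> ` I"
    using J(1) by (meson finite_subset_image)
  obtain N where N: "\<forall>n\<in>I. n \<le> N" using I(1) finite_nat_set_iff_bounded_le by auto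
  show thesis
  proof
    show "(1 / 2 ^ N :: real) > 0" by simp
    fix x y :: "'g \<Rightarrow> 'c" and \<alpha>
    assume D: "D x y < 1 / 2 ^ N" and \<alpha>: "\<alpha> \<in> J"
    obtain n where n: "n \<in> I" "\<alpha> = \<beta> n" using \<alpha> I(3) by blast
    have "(1 / 2 ^ N :: real) \<le> 1 / 2 ^ n"
      using N n(1) by (intro divide_left_mono power_increasing) auto
    then show "x \<alpha> = y \<alpha>" using product_dist_small_imp_eq[of \<Gamma> \<beta> x y n] D n I(2) by force
  qed
qed

lemma nhd_contains_cylinder:
  assumes "open_nhd Z D x V"
  obtains J where "finite J" "J \<subseteq> \<Gamma>" "\<And>y. y \<in> Z \<Longrightarrow> (\<And>\<alpha>. \<alpha> \<in> J \<Longrightarrow> y \<alpha> = x \<alpha>) \<Longrightarrow> y \<in> V"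
proof -
  have V: "openin mtopology V" "x \<in> V" using assms by (auto simp: open_nhd_def)
  then obtain r where r: "r > 0" "mball x r \<subseteq> V" unfolding openin_mtopology by blast
  have x: "x \<in> Z" using V openin_subset by fastforce
  obtain N where N: "1 / 2 ^ N < r" using half_power_less[OF r(1)] by blast
  show thesis
  proof
    show "finite (initial_coords N)" "initial_coords N \<subseteq> \<Gamma>"
      by (rule finite_initial_coords, rule initial_coords_subset)
    fix y assume y: "y \<in> Z" "\<And>\<alpha>. \<alpha> \<in> initial_coords N \<Longrightarrow> y \<alpha> = x \<alpha>"
    then have "D x y \<le> 1 / 2 ^ N" by (intro dist_le_if_eq_on_initial_coords) simp
    then show "y \<in> V" using r(2) N x y(1) by auto
  qed
qed

text \<open>
  By quasi-periodicity the orbits of the first \<open>N\<close> coordinates form a finite set; points agreeing there have iterates that agree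
  on the first \<open>N\<close> coordinates at all times.
\<close>
lemma equicontinuous_generalized_shift:
  assumes "\<forall>\<alpha>\<in>\<Gamma>. quasi_periodic \<phi> \<alpha>"
  shows "equicontinuous_iterates \<sigma>"
  unfolding equicontinuous_iterates_def
proof (intro allI impI)
  fix \<epsilon> :: real assume "\<epsilon> > 0"
  then obtain N where N: "1 / 2 ^ N < \<epsilon>" using half_power_less by blast
  define J where "J = (\<Union>\<alpha>\<in>initial_coords N. range (\<lambda>n. (\<phi> ^^ n) \<alpha>))"
  have "finite J"
    unfolding J_def using assms finite_initial_coords initial_coords_subset
    by (intro finite_UN_I finite_orbit_if_quasi_periodic) auto
  moreover have "J \<subseteq> \<Gamma>" using initial_coords_subset orbit_in by (auto simp: J_def)
  ultimately obtain \<delta> where \<delta>: "\<delta> > 0"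
    "\<And>x y :: 'g \<Rightarrow> 'x. \<And>\<alpha>. D x y < \<delta> \<Longrightarrow> \<alpha> \<in> J \<Longrightarrow> x \<alpha> = y \<alpha>"
    using eq_on_finite_if_close by blast
  have "D ((\<sigma> ^^ n) x) ((\<sigma> ^^ n) y) \<le> \<epsilon>" if "D x y < \<delta>" for x y :: "'g \<Rightarrow> 'x" and n
  proof -
    have "D ((\<sigma> ^^ n) x) ((\<sigma> ^^ n) y) \<le> 1 / 2 ^ N"
    proof (rule dist_le_if_eq_on_initial_coords)
      fix \<alpha> assume \<alpha>: "\<alpha> \<in> initial_coords N"
      then have "(\<phi> ^^ n) \<alpha> \<in> J" by (auto simp: J_def)
      then have "x ((\<phi> ^^ n) \<alpha>) = y ((\<phi> ^^ n) \<alpha>)" by (rule \<delta>(2)[OF that])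
      moreover have "\<alpha> \<in> \<Gamma>" using \<alpha> initial_coords_subset by blast
      ultimately show "(\<sigma> ^^ n) x \<alpha> = (\<sigma> ^^ n) y \<alpha>" by (simp add: funpow_shift)
    qed
    then show ?thesis using N by simp
  qed
  then show "\<exists>\<delta>>0. \<forall>x\<in>Z. \<forall>y\<in>Z. D x y < \<delta> \<longrightarrow> (\<forall>n. D ((\<sigma> ^^ n) x) ((\<sigma> ^^ n) y) \<le> \<epsilon>)"
    using \<delta>(1) by (intro exI[of _ \<delta>]) simp
qed

end


section \<open>Shifts with a non-quasi-periodic point\<close>

text \<open>
  The orbit of \<open>a\<close> is free of repetitions; \<open>k\<close> is the index of \<open>a\<close> in the enumeration, so that seeing different
  symbols at \<open>a\<close> costs a distance of at least \<open>1 / 2 ^ k\<close>; \<open>p\<close> and \<open>q\<close> are two symbols to switch between.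
\<close>
locale free_orbit_shift = shift_system X \<Gamma> \<phi> \<beta>
  for X :: "'x set" and \<Gamma> :: "'g set" and \<phi> :: "'g \<Rightarrow> 'g" and \<beta> :: "nat \<Rightarrow> 'g" +
  fixes a :: 'g and k :: nat and p q :: 'x
  assumes a: "a \<in> \<Gamma>" and inj: "inj (\<lambda>n. (\<phi> ^^ n) a)"
    and k: "k \<in> enum_index \<Gamma>" "\<beta> k = a"
    and pq: "p \<in> X" "q \<in> X" "p \<noteq> q"
begin

lemma orbit_eq_iff: "(\<phi> ^^ m) a = (\<phi> ^^ n) a \<longleftrightarrow> m = n"
  using inj by (auto simp: inj_on_def)

lemma dist_ge_if_differ_on_orbit:
  assumes "x ((\<phi> ^^ n) a) \<noteq> y ((\<phi> ^^ n) a)"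
  shows "1 / 2 ^ k \<le> D ((\<sigma> ^^ n) x) ((\<sigma> ^^ n) y)"
  by (rule product_dist_ge_if_differ) (use assms k a in \<open>simp_all add: funpow_shift\<close>)

lemma orbit_eventually_leaves_finite_set:
  assumes "finite J"
  obtains n\<^sub>0 where "\<And>n. n \<ge> n\<^sub>0 \<Longrightarrow> (\<phi> ^^ n) a \<notin> J"
proof -
  have "finite ((\<lambda>n. (\<phi> ^^ n) a) -` J)" using assms inj by (rule finite_vimageI)
  then obtain n\<^sub>0 where "(\<lambda>n. (\<phi> ^^ n) a) -` J \<subseteq> {..<n\<^sub>0}" using finite_nat_bounded by blast
  then show thesis by (intro that[of n\<^sub>0]) auto
qed

definition change_on :: "'g set \<Rightarrow> ('g \<Rightarrow> 'x) \<Rightarrow> 'g \<Rightarrow> 'x" where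
  "change_on A x \<alpha> = (if \<alpha> \<in> A then if x \<alpha> = p then q else p else x \<alpha>)"

lemma change_on_neq_iff: "change_on A x \<alpha> \<noteq> x \<alpha> \<longleftrightarrow> \<alpha> \<in> A"
  using pq by (auto simp: change_on_def)

lemma change_on_in: "x \<in> Z \<Longrightarrow> A \<subseteq> \<Gamma> \<Longrightarrow> change_on A x \<in> Z"
  using pq by (auto simp: change_on_def PiE_def Pi_def extensional_def)

text \<open>
  A neighbourhood of \<open>x\<close> only fixes finitely many coordinates, which the orbit of \<open>a\<close> leaves for good at some
  time; changing \<open>x\<close> on the rest of the orbit makes the symbols at \<open>a\<close> differ at all later times.
  The sensitivity constant is half of \<open>1 / 2 ^ k\<close> because it has to be exceeded strictly.
\<close>
lemma strongly_sensitive_shift: "strongly_sensitive Z D \<sigma>"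
  unfolding strongly_sensitive_def
proof (intro exI[of _ "1 / 2 ^ Suc k"] conjI ballI allI impI)
  fix x V assume x: "x \<in> Z" and V: "open_nhd Z D x V"
  obtain J where J: "finite J" "J \<subseteq> \<Gamma>" "\<And>y. y \<in> Z \<Longrightarrow> (\<And>\<alpha>. \<alpha> \<in> J \<Longrightarrow> y \<alpha> = x \<alpha>) \<Longrightarrow> y \<in> V"
    using nhd_contains_cylinder[OF V] by blast
  obtain n\<^sub>0 where n\<^sub>0: "\<And>n. n \<ge> n\<^sub>0 \<Longrightarrow> (\<phi> ^^ n) a \<notin> J"
    using orbit_eventually_leaves_finite_set[OF J(1)] by blast
  define y where "y = change_on ((\<lambda>n. (\<phi> ^^ n) a) ` {n\<^sub>0..}) x"
  have "y \<in> V"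
  proof (rule J(3))
    show "y \<in> Z" unfolding y_def by (rule change_on_in[OF x]) (use orbit_in a in auto)
    show "y \<alpha> = x \<alpha>" if "\<alpha> \<in> J" for \<alpha>
      using that n\<^sub>0 unfolding y_def by (subst not_not[symmetric], subst change_on_neq_iff) auto
  qed
  moreover have "1 / 2 ^ Suc k < D ((\<sigma> ^^ n) x) ((\<sigma> ^^ n) y)" if "n \<ge> n\<^sub>0" for n
  proof -
    have "x ((\<phi> ^^ n) a) \<noteq> y ((\<phi> ^^ n) a)"
      using that change_on_neq_iff unfolding y_def by (metis atLeast_iff imageI)
    then have "1 / 2 ^ k \<le> D ((\<sigma> ^^ n) x) ((\<sigma> ^^ n) y)" by (rule dist_ge_if_differ_on_orbit)
    with half_power_Suc_less show ?thesis by (rule less_le_trans)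
  qed
  ultimately show "\<exists>n\<^sub>0. \<exists>y\<in>V. \<forall>n\<ge>n\<^sub>0. 1 / 2 ^ Suc k < D ((\<sigma> ^^ n) x) ((\<sigma> ^^ n) y)" by blast
qed simp

text \<open>
  The number \<open>m\<^sup>2 + m\<close> lies in the middle of the gap between \<open>m\<^sup>2\<close> and \<open>(m + 1)\<^sup>2\<close>. If the orbit of \<open>b\<close> ever
  joins that of \<open>a\<close>, it does so with a constant time lag, which the gap exceeds for large \<open>m\<close>.
\<close>
lemma eventually_avoids_square_times:
  "\<forall>\<^sub>F m in sequentially. (\<phi> ^^ (m\<^sup>2 + m)) b \<notin> range (\<lambda>i. (\<phi> ^^ (i\<^sup>2)) a)"
proof (cases "\<exists>s t. (\<phi> ^^ s) b = (\<phi> ^^ t) a")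
  case True
  then obtain s t where st: "(\<phi> ^^ s) b = (\<phi> ^^ t) a" by blast
  have "(\<phi> ^^ (m\<^sup>2 + m)) b \<noteq> (\<phi> ^^ (i\<^sup>2)) a" if m: "m > s + t" for m i
  proof
    assume eq: "(\<phi> ^^ (m\<^sup>2 + m)) b = (\<phi> ^^ (i\<^sup>2)) a"
    have "(\<phi> ^^ (m\<^sup>2 + m)) b = (\<phi> ^^ (m\<^sup>2 + m - s)) ((\<phi> ^^ s) b)"
      using m by (simp add: funpow_add[symmetric, THEN fun_cong, unfolded comp_apply])
    also have "\<dots> = (\<phi> ^^ (m\<^sup>2 + m - s + t)) a" by (simp add: st funpow_add)
    finally have "m\<^sup>2 + m - s + t = i\<^sup>2" using eq orbit_eq_iff by simp
    then have "m\<^sup>2 < i\<^sup>2" "i\<^sup>2 < (Suc m)\<^sup>2" using m by (auto simp: power2_eq_square)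
    then have "m < i" "i < Suc m" by (auto dest: power_less_imp_less_base)
    then show False by simp
  qed
  then have "\<forall>m\<ge>Suc (s + t). (\<phi> ^^ (m\<^sup>2 + m)) b \<notin> range (\<lambda>i. (\<phi> ^^ (i\<^sup>2)) a)"
    by (auto simp: Suc_le_eq)
  then show ?thesis unfolding eventually_sequentially by blast
qed (auto intro!: always_eventually)

text \<open>
  At time \<open>m\<^sup>2 + m\<close> no difference is visible in the first \<open>N\<close> coordinates once \<open>m\<close> is large, so the distance
  is at most \<open>1 / 2 ^ N\<close> there; at infinitely many square times the difference sits at \<open>a\<close> itself.
\<close>
lemma scrambled_if_differ_on_square_times:
  assumes x: "x \<in> Z" and y: "y \<in> Z"
    and only: "\<And>\<alpha>. \<alpha> \<in> \<Gamma> \<Longrightarrow> x \<alpha> \<noteq> y \<alpha> \<Longrightarrow> \<alpha> \<in> range (\<lambda>i. (\<phi> ^^ (i\<^sup>2)) a)"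
    and inf: "infinite {i. x ((\<phi> ^^ (i\<^sup>2)) a) \<noteq> y ((\<phi> ^^ (i\<^sup>2)) a)}"
  shows "(x, y) \<in> scrambled_pairs_above (1 / 2 ^ Suc k) Z D \<sigma>"
proof -
  let ?u = "\<lambda>n. D ((\<sigma> ^^ n) x) ((\<sigma> ^^ n) y)"
  have liminf: "liminf (\<lambda>n. ereal (?u n)) = 0"
  proof (rule liminf_eq_0_if_frequently_small)
    fix e :: real assume "e > 0"
    then obtain N where N: "1 / 2 ^ N < e" using half_power_less by blast
    have "\<forall>\<^sub>F m in sequentially. \<forall>b\<in>initial_coords N.
        (\<phi> ^^ (m\<^sup>2 + m)) b \<notin> range (\<lambda>i. (\<phi> ^^ (i\<^sup>2)) a)"
      by (rule eventually_ball_finite[OF finite_initial_coords])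
        (use eventually_avoids_square_times in blast)
    then obtain M where M: "\<And>m b. m \<ge> M \<Longrightarrow> b \<in> initial_coords N \<Longrightarrow>
        (\<phi> ^^ (m\<^sup>2 + m)) b \<notin> range (\<lambda>i. (\<phi> ^^ (i\<^sup>2)) a)"
      unfolding eventually_sequentially by blast
    have small: "?u (m\<^sup>2 + m) \<le> e" if "m \<ge> M" for m
    proof -
      have "?u (m\<^sup>2 + m) \<le> 1 / 2 ^ N"
      proof (rule dist_le_if_eq_on_initial_coords)
        fix b assume b: "b \<in> initial_coords N"
        then have "b \<in> \<Gamma>" using initial_coords_subset by blast
        then show "(\<sigma> ^^ (m\<^sup>2 + m)) x b = (\<sigma> ^^ (m\<^sup>2 + m)) y b"
          using only[of "(\<phi> ^^ (m\<^sup>2 + m)) b"] M[OF that b] orbit_in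
          by (simp only: funpow_shift) blast
      qed
      then show ?thesis using N by simp
    qed
    show "\<exists>\<^sub>F n in sequentially. ?u n \<le> e"
      unfolding frequently_sequentially
    proof
      fix n\<^sub>0
      have "max M n\<^sub>0 \<le> (max M n\<^sub>0)\<^sup>2 + max M n\<^sub>0" by simp
      then show "\<exists>n\<ge>n\<^sub>0. ?u n \<le> e"
        using small[of "max M n\<^sub>0"] by (meson max.cobounded1 max.cobounded2 order_trans)
    qed
  qed simp
  have "ereal (1 / 2 ^ k) \<le> limsup (\<lambda>n. ereal (?u n))"
  proof (rule limsup_ge_if_frequently_ge, unfold frequently_sequentially, intro allI)
    fix n\<^sub>0
    obtain i where i: "i \<ge> n\<^sub>0" "x ((\<phi> ^^ (i\<^sup>2)) a) \<noteq> y ((\<phi> ^^ (i\<^sup>2)) a)"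
      using inf unfolding infinite_nat_iff_unbounded_le by blast
    have "n\<^sub>0 \<le> i\<^sup>2" using i(1) by (metis order_trans le_square power2_eq_square)
    then show "\<exists>n\<ge>n\<^sub>0. 1 / 2 ^ k \<le> ?u n"
      using dist_ge_if_differ_on_orbit[where x = x and y = y and n = "i\<^sup>2", OF i(2)] by blast
  qed
  moreover have "ereal (1 / 2 ^ Suc k) < ereal (1 / 2 ^ k)"
    using half_power_Suc_less by (simp only: ereal_less_eq less_ereal.simps)
  ultimately have above: "ereal (1 / 2 ^ Suc k) < limsup (\<lambda>n. ereal (?u n))"
    by (rule less_le_trans[rotated])
  moreover have "0 < ereal (1 / 2 ^ Suc k)" by simp
  ultimately have "0 < limsup (\<lambda>n. ereal (?u n))" by (rule less_trans[rotated])
  with liminf above x y show ?thesis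
    unfolding scrambled_pairs_above_def scrambled_pairs_def by blast
qed

lemma Li_Yorke_sensitive_shift: "Li_Yorke_sensitive Z D \<sigma>"
  unfolding Li_Yorke_sensitive_def
proof (intro exI[of _ "1 / 2 ^ Suc k"] conjI ballI allI impI)
  fix x V assume x: "x \<in> Z" and V: "open_nhd Z D x V"
  obtain J where J: "finite J" "J \<subseteq> \<Gamma>" "\<And>y. y \<in> Z \<Longrightarrow> (\<And>\<alpha>. \<alpha> \<in> J \<Longrightarrow> y \<alpha> = x \<alpha>) \<Longrightarrow> y \<in> V"
    using nhd_contains_cylinder[OF V] by blast
  obtain n\<^sub>0 where n\<^sub>0: "\<And>n. n \<ge> n\<^sub>0 \<Longrightarrow> (\<phi> ^^ n) a \<notin> J"
    using orbit_eventually_leaves_finite_set[OF J(1)] by blast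
  define y where "y = change_on ((\<lambda>i. (\<phi> ^^ (i\<^sup>2)) a) ` {n\<^sub>0..}) x"
  have neq: "x \<alpha> \<noteq> y \<alpha> \<longleftrightarrow> \<alpha> \<in> (\<lambda>i. (\<phi> ^^ (i\<^sup>2)) a) ` {n\<^sub>0..}" for \<alpha>
    unfolding y_def using change_on_neq_iff by metis
  have yZ: "y \<in> Z" unfolding y_def by (rule change_on_in[OF x]) (use orbit_in a in auto)
  have "y \<in> V"
  proof (rule J(3)[OF yZ])
    fix \<alpha> assume \<alpha>: "\<alpha> \<in> J"
    have "(\<phi> ^^ (i\<^sup>2)) a \<notin> J" if "i \<ge> n\<^sub>0" for i
      by (rule n\<^sub>0) (use that in \<open>metis order_trans le_square power2_eq_square\<close>)
    then show "y \<alpha> = x \<alpha>" using neq[of \<alpha>] \<alpha> by auto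
  qed
  moreover have "(x, y) \<in> scrambled_pairs_above (1 / 2 ^ Suc k) Z D \<sigma>"
  proof (rule scrambled_if_differ_on_square_times[OF x yZ])
    show "\<alpha> \<in> range (\<lambda>i. (\<phi> ^^ (i\<^sup>2)) a)" if "x \<alpha> \<noteq> y \<alpha>" for \<alpha> using that neq by blast
    have "{n\<^sub>0..} \<subseteq> {i. x ((\<phi> ^^ (i\<^sup>2)) a) \<noteq> y ((\<phi> ^^ (i\<^sup>2)) a)}" using neq by blast
    then show "infinite {i. x ((\<phi> ^^ (i\<^sup>2)) a) \<noteq> y ((\<phi> ^^ (i\<^sup>2)) a)}"
      using infinite_Ici infinite_super by blast
  qed
  ultimately show "\<exists>y\<in>V. (x, y) \<in> scrambled_pairs_above (1 / 2 ^ Suc k) Z D \<sigma>" by blast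
qed simp

text \<open>
  The code of a set \<open>B\<close> of naturals: the symbol at time \<open>i\<^sup>2\<close> records whether the first component of the pair
  numbered \<open>i\<close> lies in \<open>B\<close>. Every natural is such a component infinitely often, so that a single element
  distinguishing two sets makes their codes differ infinitely often.
\<close>
definition code_set :: "nat set \<Rightarrow> 'g \<Rightarrow> 'x" where
  "code_set B = (\<lambda>\<alpha>\<in>\<Gamma>. if \<exists>i. fst (prod_decode i) \<in> B \<and> \<alpha> = (\<phi> ^^ (i\<^sup>2)) a then q else p)"

lemma code_set_at_square_time:
  "code_set B ((\<phi> ^^ (i\<^sup>2)) a) = (if fst (prod_decode i) \<in> B then q else p)"
  using orbit_in[OF a] by (auto simp: code_set_def orbit_eq_iff)

lemma scrambled_code_sets:
  assumes "B \<noteq> C"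
  shows "(code_set B, code_set C) \<in> scrambled_pairs_above (1 / 2 ^ Suc k) Z D \<sigma>"
proof (rule scrambled_if_differ_on_square_times)
  show "code_set B \<in> Z" "code_set C \<in> Z" using pq by (auto simp: code_set_def)
  show "\<alpha> \<in> range (\<lambda>i. (\<phi> ^^ (i\<^sup>2)) a)" if "code_set B \<alpha> \<noteq> code_set C \<alpha>" for \<alpha>
    using that by (auto simp: code_set_def restrict_def split: if_splits)
  obtain j where j: "j \<in> B \<longleftrightarrow> j \<notin> C" using assms by blast
  have "inj (\<lambda>m. prod_encode (j, m))" by (auto intro!: injI)
  then have "infinite (range (\<lambda>m. prod_encode (j, m)))" by (rule range_inj_infinite)
  moreover have "range (\<lambda>m. prod_encode (j, m))
      \<subseteq> {i. code_set B ((\<phi> ^^ (i\<^sup>2)) a) \<noteq> code_set C ((\<phi> ^^ (i\<^sup>2)) a)}"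
    using j pq by (auto simp: code_set_at_square_time)
  ultimately show "infinite {i. code_set B ((\<phi> ^^ (i\<^sup>2)) a) \<noteq> code_set C ((\<phi> ^^ (i\<^sup>2)) a)}"
    using infinite_super by blast
qed

lemma Li_Yorke_chaotic_shift: "Li_Yorke_chaotic Z D \<sigma>"
proof -
  have scr: "(code_set B, code_set C) \<in> scrambled_pairs Z D \<sigma>" if "B \<noteq> C" for B C
    using scrambled_code_sets[OF that] by (auto simp: scrambled_pairs_above_def)
  have inj_code: "inj code_set"
  proof (rule injI, rule ccontr)
    fix B C assume eq: "code_set B = code_set C" and "B \<noteq> C"
    \<comment> \<open>A point paired with itself has limit superior zero, so it is not scrambled.\<close>
    from scr[OF this(2)] eq show False
      by (auto simp: scrambled_pairs_def product_dist_def Limsup_const zero_ereal_def[symmetric])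
  qed
  have "uncountable (UNIV :: nat set set)"
    unfolding uncountable_def using Cantors_theorem[of "UNIV :: nat set"] by auto
  then have "uncountable (range code_set)" using countable_image_inj_eq[OF inj_code] by simp
  moreover have "scrambled_set Z D \<sigma> (range code_set)"
    unfolding scrambled_set_def
  proof (intro conjI)
    show "range code_set \<subseteq> Z" using pq by (auto simp: code_set_def)
    have "code_set {} \<noteq> code_set UNIV" using inj_code by (auto dest: injD)
    then show "\<exists>x\<in>range code_set. \<exists>y\<in>range code_set. x \<noteq> y" by blast
    show "\<forall>x\<in>range code_set. \<forall>y\<in>range code_set. x \<noteq> y \<longrightarrow> (x, y) \<in> scrambled_pairs Z D \<sigma>"
      by (auto intro!: scr)
  qed
  ultimately show ?thesis unfolding Li_Yorke_chaotic_def by (intro exI conjI)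
qed

text \<open>
  The partition by the symbol at \<open>a\<close> realises every word, so its entropy \<open>ln (card X)\<close> is a positive
  lower bound for the topological entropy.
\<close>
lemma topologically_chaotic_shift:
  assumes fin: "finite X"
  shows "topologically_chaotic Z D \<sigma>"
proof -
  define C where "C c = {z \<in> Z. z a = c}" for c
  have C_openin: "openin mtopology (C c)" for c
  proof -
    have "\<exists>r>0. mball x r \<subseteq> C c" if x: "x \<in> C c" for x
    proof -
      obtain \<delta> where \<delta>: "\<delta> > 0" "\<And>x y :: 'g \<Rightarrow> 'x. \<And>\<alpha>. D x y < \<delta> \<Longrightarrow> \<alpha> \<in> {a} \<Longrightarrow> x \<alpha> = y \<alpha>"
        using eq_on_finite_if_close[of "{a}"] a by blast
      have "y \<in> C c" if "y \<in> mball x \<delta>" for y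
        using \<delta>(2)[of x y a] that x by (simp add: C_def)
      then show ?thesis using \<delta>(1) by blast
    qed
    then show ?thesis unfolding openin_mtopology by (auto simp: C_def)
  qed
  have cover: "\<Union>(C ` X) = Z" using a by (auto simp: C_def)
  \<comment> \<open>As the orbit of \<open>a\<close> is injective, a word is realised by writing its letters along the orbit.\<close>
  have realise: "\<exists>z\<in>Z. \<forall>i. z ((\<phi> ^^ i) a) = w i" if w: "\<And>i. w i \<in> X" for w :: "nat \<Rightarrow> 'x"
  proof (intro bexI allI)
    let ?z = "\<lambda>\<alpha>\<in>\<Gamma>. w (inv (\<lambda>n. (\<phi> ^^ n) a) \<alpha>)"
    show "?z \<in> Z" using w by auto
    show "?z ((\<phi> ^^ i) a) = w i" for i using orbit_in[OF a] inv_f_f[OF inj] by simp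
  qed
  have C_disj: "P = Q" if "P \<in> C ` X" "Q \<in> C ` X" "P \<inter> Q \<noteq> {}" for P Q
    using that by (auto simp: C_def)
  have "C c \<noteq> {}" if c: "c \<in> X" for c
  proof -
    obtain z where z: "z \<in> Z" "\<And>i. z ((\<phi> ^^ i) a) = c" using realise[of "\<lambda>_. c"] c by blast
    have "z a = c" using z(2)[of 0] by simp
    then show ?thesis using z(1) by (auto simp: C_def)
  qed
  then have "inj_on C X" by (intro inj_onI) (auto simp: C_def)
  then have card: "card (C ` X) = card X" by (rule card_image)
  have "cover_entropy mtopology \<sigma> (C ` X) = ln (real (card (C ` X)))"
  proof (rule cover_entropy_partition)
    fix n :: nat and V assume "\<forall>i<n. V i \<in> C ` X"
    then have "\<forall>i. \<exists>c. i < n \<longrightarrow> c \<in> X \<and> V i = C c" by auto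
    then obtain w where w: "\<And>i. i < n \<Longrightarrow> w i \<in> X \<and> V i = C (w i)" by (elim choice[THEN exE]) blast
    define w' where "w' i = (if i < n then w i else p)" for i
    have "w' i \<in> X" for i using w pq by (simp add: w'_def)
    then obtain z where z: "z \<in> Z" "\<And>i. z ((\<phi> ^^ i) a) = w' i" using realise[of w'] by blast
    have "(\<sigma> ^^ i) z \<in> V i" if "i < n" for i
      using w[OF that] z funpow_in_carrier[OF shift_funcset z(1), of i] that
      by (auto simp: C_def funpow_shift[OF a] w'_def)
    then show "\<exists>z\<in>topspace mtopology. \<forall>i<n. (\<sigma> ^^ i) z \<in> V i" using z(1) by auto
  qed (use fin cover shift_funcset C_disj in auto)
  moreover have "card X \<ge> 2"
    using card_mono[OF fin, of "{p, q}"] pq by simp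
  ultimately have "0 < ereal (cover_entropy mtopology \<sigma> (C ` X))" by (simp add: card)
  also have "\<dots> \<le> topological_entropy mtopology \<sigma>"
    unfolding topological_entropy_def
    by (rule SUP_upper) (use C_openin cover in \<open>auto simp: open_covers_def\<close>)
  finally show ?thesis unfolding topologically_chaotic_def .
qed

end


section \<open>The equivalence\<close>

theorem theorem4p12:
  fixes X :: "'x set" and \<Gamma> :: "'g set" and \<phi> :: "'g \<Rightarrow> 'g" and \<beta> :: "nat \<Rightarrow> 'g"
  assumes "finite X" and "card X \<ge> 2"
    and "countable \<Gamma>" and "\<Gamma> \<noteq> {}"
    and "\<phi> \<in> \<Gamma> \<rightarrow> \<Gamma>"
    and "is_enumeration \<beta> \<Gamma>"
  shows "let Z = \<Gamma> \<rightarrow>\<^sub>E X;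
             D = product_dist \<Gamma> \<beta>;
             \<sigma> = generalized_shift \<Gamma> \<phi>;
             nqp = (\<exists>a\<in>\<Gamma>. \<not> quasi_periodic \<phi> a)
         in (Li_Yorke_chaotic Z D \<sigma> \<longleftrightarrow> nqp) \<and>
            (topologically_chaotic Z D \<sigma> \<longleftrightarrow> nqp) \<and>
            (spatiotemporally_chaotic Z D \<sigma> \<longleftrightarrow> nqp) \<and>
            (sensitive Z D \<sigma> \<longleftrightarrow> nqp) \<and>
            (Li_Yorke_sensitive Z D \<sigma> \<longleftrightarrow> nqp) \<and>
            (strongly_sensitive Z D \<sigma> \<longleftrightarrow> nqp) \<and>
            (asymptotic_sensitive Z D \<sigma> \<longleftrightarrow> nqp) \<and>
            (syndetically_sensitive Z D \<sigma> \<longleftrightarrow> nqp) \<and>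
            (cofinitely_sensitive Z D \<sigma> \<longleftrightarrow> nqp) \<and>
            (multi_sensitive Z D \<sigma> \<longleftrightarrow> nqp) \<and>
            (ergodically_sensitive Z D \<sigma> \<longleftrightarrow> nqp)"
proof -
  interpret shift_system X \<Gamma> \<phi> \<beta> using assms by unfold_locales auto
  have above_sensitive:
    "strongly_sensitive Z D \<sigma> \<Longrightarrow> sensitive Z D \<sigma>"
    "asymptotic_sensitive Z D \<sigma> \<Longrightarrow> sensitive Z D \<sigma>"
    "Li_Yorke_sensitive Z D \<sigma> \<Longrightarrow> sensitive Z D \<sigma>"
    "cofinitely_sensitive Z D \<sigma> \<Longrightarrow> sensitive Z D \<sigma>"
    "syndetically_sensitive Z D \<sigma> \<Longrightarrow> sensitive Z D \<sigma>"
    "multi_sensitive Z D \<sigma> \<Longrightarrow> sensitive Z D \<sigma>"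
    "ergodically_sensitive Z D \<sigma> \<Longrightarrow> sensitive Z D \<sigma>"
    using strongly_sensitive_imp_asymptotic_sensitive asymptotic_sensitive_imp_sensitive
      Li_Yorke_sensitive_imp_asymptotic_sensitive cofinitely_sensitive_imp_multi_sensitive
      syndetically_sensitive_imp_sensitive[OF shift_funcset]
      multi_sensitive_imp_sensitive[OF shift_funcset]
      ergodically_sensitive_imp_sensitive[OF shift_funcset] by blast+
  show ?thesis
  proof (cases "\<exists>a\<in>\<Gamma>. \<not> quasi_periodic \<phi> a")
    case True
    then obtain a where a: "a \<in> \<Gamma>" "\<not> quasi_periodic \<phi> a" by blast
    have "a \<in> \<beta> ` enum_index \<Gamma>" using a(1) enum by (simp add: is_enumeration_def bij_betw_def)
    then obtain k where k: "k \<in> enum_index \<Gamma>" "\<beta> k = a" by auto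
    have "\<not> (\<forall>p\<in>X. \<forall>q\<in>X. p = q)"
      using assms(2) card_le_Suc0_iff_eq[OF assms(1)] by auto
    then obtain p q where pq: "p \<in> X" "q \<in> X" "p \<noteq> q" by auto
    interpret free_orbit_shift X \<Gamma> \<phi> \<beta> a k p q
      using a(1) k pq inj_orbit_if_not_quasi_periodic[OF a(2)] by unfold_locales
    note strong = strongly_sensitive_shift and LY = Li_Yorke_sensitive_shift
    note cofin = strongly_sensitive_imp_cofinitely_sensitive[OF strong]
    show ?thesis
      using True strong LY cofin above_sensitive(1)[OF strong]
        Li_Yorke_chaotic_shift topologically_chaotic_shift[OF assms(1)]
        Li_Yorke_sensitive_imp_spatiotemporally_chaotic[OF LY]
        strongly_sensitive_imp_asymptotic_sensitive[OF strong]
        cofinitely_sensitive_imp_syndetically_sensitive[OF cofin]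
        cofinitely_sensitive_imp_multi_sensitive[OF cofin]
        cofinitely_sensitive_imp_ergodically_sensitive[OF cofin]
      unfolding Let_def by blast
  next
    case False
    then have eq: "equicontinuous_iterates \<sigma>" using equicontinuous_generalized_shift by blast
    have "X \<noteq> {}" using assms(2) by auto
    then have ne: "Z \<noteq> {}" by (simp add: PiE_eq_empty_iff)
    note not_sensitive = equicontinuous_imp_not_sensitive[OF eq ne]
    note no_scrambled = equicontinuous_imp_no_scrambled_pairs[OF shift_funcset eq]
    have "\<not> topologically_chaotic Z D \<sigma>"
      using shift_funcset eq compact_space_product_dist[OF enum assms(1)]
      by (rule equicontinuous_imp_not_topologically_chaotic)
    moreover have "\<not> Li_Yorke_chaotic Z D \<sigma>"
      unfolding Li_Yorke_chaotic_def scrambled_set_def no_scrambled by blast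
    moreover have "\<not> spatiotemporally_chaotic Z D \<sigma>"
    proof -
      obtain x where "x \<in> Z" using ne by blast
      moreover from this have "open_nhd Z D x Z" by (auto simp: open_nhd_def)
      ultimately show ?thesis unfolding spatiotemporally_chaotic_def no_scrambled by blast
    qed
    ultimately show ?thesis
      using False not_sensitive above_sensitive unfolding Let_def by blast
  qed
qed

end
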